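(* Let $M,N$ be non-negative integers and let $q,a,A,B,b,c,b',c'$ be nonzero complex numbers with $|q|<1$, such that no denominator appearing below vanishes (and all the shifted factorials below are defined). Then $$\sum_{n=0}^{M}\sum_{l=0}^{N}\frac{(A/a;q)_{n-l}}{(qa/B;q)_{n-l}}\cdot\frac{(AB/a;q)_{n+l}}{(qa;q)_{n+l}}\cdot\frac{\left(A,q\sqrt A,-q\sqrt A,b,c,\frac{Aaq^{1+M}}{bc},\frac{qa}{B},q^{-M};q\right)_n}{\left(\sqrt A,-\sqrt A,\frac{qA}{b},\frac{qA}{c},\frac{bcq^{-M}}{a},\frac{AB}{a},Aq^{1+M};q\right)_n}$$ $$\times\frac{\left(B,q\sqrt B,-q\sqrt B,b',c',\frac{Baq^{1+N}}{b'c'},\frac{qa}{A},q^{-N};q\right)_l}{\left(\sqrt B,-\sqrt B,\frac{qB}{b'},\frac{qB}{c'},\frac{b'c'q^{-N}}{a},\frac{AB}{a},Bq^{1+N};q\right)_l}\cdot\frac{q^n\left(\frac{AB}{a^2}\right)^l}{(q;q)_n(q;q)_l}$$ $$=\frac{\left(qA,\frac{qa}{b},\frac{qa}{c},\frac{qA}{bc};q\right)_M}{\left(qa,\frac{qA}{b},\frac{qA}{c},\frac{qa}{bc};q\right)_M}\cdot\frac{\left(qB,\frac{qa}{b'},\frac{qa}{c'},\frac{qB}{b'c'};q\right)_N}{\left(qa,\frac{qB}{b'},\frac{qB}{c'},\frac{qa}{b'c'};q\right)_N}$$ $$\times\;{}_{12}W_{11}\!\left(a;\frac{qa^2}{AB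},b,c,b',c',\frac{Aaq^{1+M}}{bc},\frac{Baq^{1+N}}{b'c'},q^{-M},q^{-N};q,q\right).$$
   Context: Notation: $(x;q)_n=\prod_{j=0}^{n-1}(1-xq^j)$ for integers $n\ge0$, $(x;q)_{-n}=1/(xq^{-n};q)_n$ for $n\geq 1$, and $(x_1,\dots,x_r;q)_n=\prod_{i}(x_i;q)_n$. The very-well-poised series is $${}_{r+1}W_r(a;a_1,\dots,a_{r-2};q,z)=\sum_{m\ge0}\frac{(a,q\sqrt a,-q\sqrt a,a_1,\dots,a_{r-2};q)_m}{(q,\sqrt a,-\sqrt a,qa/a_1,\dots,qa/a_{r-2};q)_m}z^m,$$ where square roots are fixed choices (so $\frac{(q\sqrt a,-q\sqrt a;q)_m}{(\sqrt a,-\sqrt a;q)_m}=\frac{1-aq^{2m}}{1-a}$). Here it terminates because $q^{-M}$ and $q^{-N}$ are among the parameters: all terms with $m>\min(M,N)$ are zero. *)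

theory Defs
  imports Complex_Main
begin

text \<open>
  The \<open>q\<close>-shifted factorial \<open>(x;q)\<^sub>n\<close> for an integer index. For \<open>n < 0\<close> it is only meaningful if the
  finite product below the fraction bar is nonzero; statements that use a negative index have to
  assume this explicitly, as division by zero yields zero.
\<close>

definition qpoch :: "complex \<Rightarrow> complex \<Rightarrow> int \<Rightarrow> complex" where
  "qpoch x q n =
     (if n \<ge> 0 then \<Prod>j<nat n. (1 - x * q ^ j)
      else 1 / (\<Prod>j<nat (- n). (1 - x * q powi n * q ^ j)))"

definition qpochs :: "complex list \<Rightarrow> complex \<Rightarrow> int \<Rightarrow> complex" where
  "qpochs xs q n = (\<Prod>x\<leftarrow>xs. qpoch x q n)"

text \<open>
  The very-well-poised series \<open>\<^sub>r\<^sub>+\<^sub>1W\<^sub>r(a; as; q, z)\<close>, where \<open>length as = r - 2\<close>. The choice of the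
  square root is immaterial, since both roots enter symmetrically.
\<close>

definition vwp_series :: "complex \<Rightarrow> complex list \<Rightarrow> complex \<Rightarrow> complex \<Rightarrow> complex" where
  "vwp_series a as q z =
     (\<Sum>m. qpochs ([a, q * csqrt a, - q * csqrt a] @ as) q (int m) /
           qpochs ([q, csqrt a, - csqrt a] @ map (\<lambda>x. q * a / x) as) q (int m) * z ^ m)"

end

theory Submission
  imports Defs
begin

text \<open>
  Jackson's summation of the terminating very-well-poised balanced \<open>\<^sub>8\<phi>\<^sub>7\<close> series is used twice.
  With base \<open>A q\<^sup>2\<^sup>m\<close> it expands the factors of the \<open>m\<close>-th term of the single series that involve
  \<open>b\<close>, \<open>c\<close> and \<open>M\<close> as a sum over \<open>n \<ge> m\<close>, whose connection coefficients depend on \<open>a\<close>, \<open>A\<close>, \<open>m\<close> and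
  \<open>n\<close> only; likewise for \<open>b'\<close>, \<open>c'\<close> and \<open>N\<close>. After interchanging the sums, the sum over \<open>m\<close> is
  \<open>\<^sub>8W\<^sub>7(a; qa\<^sup>2/(AB), q\<^sup>-\<^sup>n, Aq\<^sup>n, q\<^sup>-\<^sup>l, Bq\<^sup>l; q, q)\<close>, which is again summed by Jackson's formula.
\<close>

section \<open>Auxiliary identities\<close>

text \<open>Jackson's formula is itself proved here, by induction on the length: the sums for
  \<open>N\<close> and \<open>N + 1\<close> both arise from one telescoping sum, which gives a
  two-term recursion. Solving the recursion divides by factors such as \<open>1 - a\<close>, so it
  covers only generic \<open>a\<close>. The inner sum over \<open>m\<close>, however, can fall on
  exceptional parameters: already for \<open>A = a\<close> and \<open>n = l = m \<ge> 1\<close> the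
  factor \<open>(aq^(1-n)/A;q)_m\<close> vanishes, while the double sum stays meaningful. The
  parameter \<open>qa^2/(AB)\<close> comes from the balancing condition of the inner sum: its
  product with \<open>q^-n\<close>, \<open>Aq^n\<close>, \<open>q^-l\<close> and \<open>Bq^l\<close>
  is \<open>qa^2\<close> for all \<open>n\<close> and \<open>l\<close>. The summand of the double
  sum looks asymmetric in \<open>(A, n)\<close> and \<open>(B, l)\<close>, through the index
  \<open>n - l\<close> and the power of \<open>AB/a^2\<close>. The part of it that couples
  \<open>n\<close> and \<open>l\<close> is nevertheless a symmetric sum over \<open>m\<close>, so
  only the case \<open>l \<le> n\<close> has to be evaluated.\<close>

text \<open>
  With \<open>u\<close> ranging over \<open>a, b, c, d, x, y\<close>, the difference of the products of \<open>1 - u K\<close> and of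
  \<open>1 - a K / u\<close>, divided by \<open>K\<^sup>3\<close>, is antisymmetric under \<open>K \<mapsto> 1 / (a K)\<close>. Hence \<open>K (1 - a K\<^sup>2)\<close> divides
  the difference; the quotient has the form \<open>\<alpha> (1 + a K\<^sup>2) + \<beta> K\<close> and is determined by its values at \<open>K = 1 / x\<close> and \<open>K = 1 / y\<close>.
\<close>

lemma six_parameter_identity:
  fixes a b c d x y K :: complex
  assumes nz: "a \<noteq> 0" "b \<noteq> 0" "c \<noteq> 0" "d \<noteq> 0" "x \<noteq> 0" "y \<noteq> 0"
    and bal: "b * c * d * x * y = a\<^sup>2"
  shows "(x - y) * ((1 - a * K) * (1 - b * K) * (1 - c * K) * (1 - d * K) * (1 - x * K) * (1 - y * K)
           - (1 - K) * (1 - a * K / b) * (1 - a * K / c) * (1 - a * K / d)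
             * (1 - a * K / x) * (1 - a * K / y))
       = K * (1 - a * K\<^sup>2) *
          (y\<^sup>2 * (1 - 1 / y) * (1 - a / (b * y)) * (1 - a / (c * y)) * (1 - a / (d * y))
             * ((1 - x * K) * (1 - a * K / x))
         - x\<^sup>2 * (1 - 1 / x) * (1 - a / (b * x)) * (1 - a / (c * x)) * (1 - a / (d * x))
             * ((1 - y * K) * (1 - a * K / y)))"
proof -
  \<comment> \<open>Balancing fixes \<open>b * c * d\<close>, so \<open>b\<close>, \<open>c\<close>,
    \<open>d\<close> enter only through \<open>s\<close> and \<open>r\<close>. After rewriting with
    1, 2 and 3, the claim is an identity of rational functions in \<open>a\<close>,
    \<open>r\<close>, \<open>s\<close>, \<open>x\<close>, \<open>y\<close>, \<open>K\<close> without
    side relations.\<close>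
  define s r where "s = b + c + d" and "r = (b * c + b * d + c * d) / a"
  have ar: "a * r = b * c + b * d + c * d"
    using nz by (simp add: r_def)
  have bcd: "b * c * d = a\<^sup>2 / (x * y)"
    using nz by (simp add: bal[symmetric])
  have 1: "(1 - b * t) * (1 - c * t) * (1 - d * t) = 1 - s * t + a * r * t\<^sup>2 - a\<^sup>2 / (x * y) * t ^ 3" for t
  proof -
    have "(1 - b * t) * (1 - c * t) * (1 - d * t) = 1 - s * t + a * r * t\<^sup>2 - b * c * d * t ^ 3"
      unfolding s_def ar by (simp add: algebra_simps power2_eq_square power3_eq_cube)
    then show ?thesis by (simp only: bcd)
  qed
  have 2: "(1 - a * t / b) * (1 - a * t / c) * (1 - a * t / d)
         = 1 - r * x * y * t + s * x * y * t\<^sup>2 - a * x * y * t ^ 3" for t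
  proof -
    have "(1 - a * t / b) * (1 - a * t / c) * (1 - a * t / d)
       = 1 - a\<^sup>2 * r / (b * c * d) * t + a\<^sup>2 * s / (b * c * d) * t\<^sup>2 - a\<^sup>2 * a / (b * c * d) * t ^ 3"
      using nz unfolding s_def r_def by (simp add: divide_simps) (simp add: algebra_simps power2_eq_square power3_eq_cube)
    then show ?thesis using nz by (simp add: bcd)
  qed
  have 3: "(1 - a / (b * t)) * (1 - a / (c * t)) * (1 - a / (d * t))
         = 1 - r * x * y / t + s * x * y / t\<^sup>2 - a * x * y / t ^ 3" if "t \<noteq> 0" for t
    using 2[of "1 / t"] that by (simp add: power_divide mult.commute)
  have "(x - y) * ((1 - a * K) * ((1 - b * K) * (1 - c * K) * (1 - d * K)) * (1 - x * K) * (1 - y * K)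
           - (1 - K) * ((1 - a * K / b) * (1 - a * K / c) * (1 - a * K / d))
             * (1 - a * K / x) * (1 - a * K / y))
       = K * (1 - a * K\<^sup>2) *
          (y\<^sup>2 * (1 - 1 / y) * ((1 - a / (b * y)) * (1 - a / (c * y)) * (1 - a / (d * y)))
             * ((1 - x * K) * (1 - a * K / x))
         - x\<^sup>2 * (1 - 1 / x) * ((1 - a / (b * x)) * (1 - a / (c * x)) * (1 - a / (d * x)))
             * ((1 - y * K) * (1 - a * K / y)))"
    unfolding 1 2 3[OF nz(5)] 3[OF nz(6)]
    using nz by (simp add: divide_simps power2_eq_square power3_eq_cube) algebra
  then show ?thesis
    by (simp only: mult.assoc)
qed

text \<open>Balancing gives \<open>a / (b * x) = c * d * y / a\<close>, the reciprocal of
  \<open>a / (c * d * y)\<close>, so every factor in \<open>a / x\<close> flips into one in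
  \<open>a / y\<close> times a monomial, and the monomials cancel. In the induction for Jackson's
  formula this compares the recursion of the sums with that of the products.\<close>

lemma balanced_ratio:
  fixes a b c d x y :: complex
  assumes nz: "a \<noteq> 0" "b \<noteq> 0" "c \<noteq> 0" "d \<noteq> 0" "x \<noteq> 0" "y \<noteq> 0"
    and bal: "b * c * d * x * y = a\<^sup>2"
  shows "x\<^sup>2 * (1 - 1 / x) * (1 - a / (b * x)) * (1 - a / (c * x)) * (1 - a / (d * x)) * (1 - y)
       * (1 - a / (b * c * d * y))
     = y\<^sup>2 * (1 - 1 / y) * (1 - x) * (1 - a / x)
       * (1 - a / (b * c * y)) * (1 - a / (b * d * y)) * (1 - a / (c * d * y))"
proof -
  have x: "x = a\<^sup>2 / (b * c * d * y)"
    using nz by (simp add: bal[symmetric])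
  have 1: "1 - a / (b * x) = - (c * d * y / a) * (1 - a / (c * d * y))"
    and 2: "1 - a / (c * x) = - (b * d * y / a) * (1 - a / (b * d * y))"
    and 3: "1 - a / (d * x) = - (b * c * y / a) * (1 - a / (b * c * y))"
    and 4: "1 - a / x = - (b * c * d * y / a) * (1 - a / (b * c * d * y))"
    using nz by (simp_all add: x power2_eq_square divide_simps)
  have 5: "x\<^sup>2 * (1 - 1 / x) = - x * (1 - x)" "y\<^sup>2 * (1 - 1 / y) = - y * (1 - y)"
    using nz by (simp_all add: power2_eq_square algebra_simps)
  have 6: "x * (c * d * y / a) * (b * d * y / a) * (b * c * y / a) = y * (b * c * d * y / a)"
    using nz by (simp add: x power2_eq_square)
  have "x\<^sup>2 * (1 - 1 / x) * (1 - a / (b * x)) * (1 - a / (c * x)) * (1 - a / (d * x)) * (1 - y)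
       * (1 - a / (b * c * d * y))
    = (x * (c * d * y / a) * (b * d * y / a) * (b * c * y / a)) * ((1 - x) * (1 - y)
       * (1 - a / (c * d * y)) * (1 - a / (b * d * y)) * (1 - a / (b * c * y)) * (1 - a / (b * c * d * y)))"
    unfolding 1 2 3 5 by simp
  also have "\<dots> = y\<^sup>2 * (1 - 1 / y) * (1 - x) * (1 - a / x)
       * (1 - a / (b * c * y)) * (1 - a / (b * d * y)) * (1 - a / (c * d * y))"
    unfolding 4 5 6 by simp
  finally show ?thesis .
qed

lemma sum_min_swap:
  fixes w :: "nat \<Rightarrow> 'a :: comm_semiring_1"
  shows "(\<Sum>n\<le>M. \<Sum>l\<le>N. \<Sum>m\<le>min n l. w m * (x n m * y l m))
    = (\<Sum>m\<le>min M N. w m * ((\<Sum>n=m..M. x n m) * (\<Sum>l=m..N. y l m)))"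
proof -
  \<comment> \<open>Extension by zero turns the triangular ranges into rectangles, on which the sums
    can be swapped and the inner double sum factors.\<close>
  define x' y' where "x' n m = (if m \<le> n then x n m else 0)" and "y' l m = (if m \<le> l then y l m else 0)"
    for n l m
  have "(\<Sum>m\<le>min n l. w m * (x n m * y l m)) = (\<Sum>m\<le>min M N. w m * (x' n m * y' l m))"
    if "n \<le> M" "l \<le> N" for n l
    by (rule sum.mono_neutral_cong_left) (use that in \<open>auto simp: x'_def y'_def\<close>)
  then have "(\<Sum>n\<le>M. \<Sum>l\<le>N. \<Sum>m\<le>min n l. w m * (x n m * y l m))
      = (\<Sum>n\<le>M. \<Sum>l\<le>N. \<Sum>m\<le>min M N. w m * (x' n m * y' l m))"
    by (intro sum.cong[OF refl, of "{..M}"] sum.cong[OF refl, of "{..N}"]) simp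
  also have "\<dots> = (\<Sum>n\<le>M. \<Sum>m\<le>min M N. \<Sum>l\<le>N. w m * (x' n m * y' l m))"
    by (intro sum.cong refl sum.swap)
  also have "\<dots> = (\<Sum>m\<le>min M N. \<Sum>n\<le>M. \<Sum>l\<le>N. w m * (x' n m * y' l m))"
    by (rule sum.swap)
  also have "\<dots> = (\<Sum>m\<le>min M N. w m * ((\<Sum>n\<le>M. x' n m) * (\<Sum>l\<le>N. y' l m)))"
    by (simp only: sum_product, simp only: sum_distrib_left)
  also have "\<dots> = (\<Sum>m\<le>min M N. w m * ((\<Sum>n=m..M. x n m) * (\<Sum>l=m..N. y l m)))"
  proof -
    have "(\<Sum>n\<le>M. x' n m) = (\<Sum>n=m..M. x n m)" for m
      by (rule sum.mono_neutral_cong_right) (auto simp: x'_def)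
    moreover have "(\<Sum>l\<le>N. y' l m) = (\<Sum>l=m..N. y l m)" for m
      by (rule sum.mono_neutral_cong_right) (auto simp: y'_def)
    ultimately show ?thesis by simp
  qed
  finally show ?thesis .
qed

section \<open>Shifted factorials\<close>

locale q_not_root_of_unity =
  fixes q :: complex
  assumes q_nonzero [simp]: "q \<noteq> 0"
    and q_power_neq_1: "k > 0 \<Longrightarrow> q ^ k \<noteq> 1"
begin

definition qfac :: "complex \<Rightarrow> nat \<Rightarrow> complex" where
  "qfac x n = (\<Prod>j<n. 1 - x * q ^ j)"

text \<open>The monomial produced by reversing the order of the factors of \<open>(x;q)_n\<close>.
  It stays an unevaluated product: only its nonvanishing, splitting and ratios matter, so the
  quadratic power of \<open>q\<close> inside it is never computed.\<close>

definition rev_factor :: "complex \<Rightarrow> nat \<Rightarrow> complex" where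
  "rev_factor x n = (\<Prod>j<n. - (x * q ^ j))"

text \<open>
  \<open>vw a n\<close> is \<open>(a, q\<surd>a, -q\<surd>a; q)\<^sub>n / (\<surd>a, -\<surd>a; q)\<^sub>n\<close>, in a form that also makes sense for \<open>a = 1\<close>.
\<close>

definition vw :: "complex \<Rightarrow> nat \<Rightarrow> complex" where
  "vw a n = (if n = 0 then 1 else (1 - a * q ^ (2 * n)) * qfac (a * q) (n - 1))"

lemma qfac_0 [simp]: "qfac x 0 = 1"
  by (simp add: qfac_def)

lemma qfac_Suc: "qfac x (Suc n) = qfac x n * (1 - x * q ^ n)"
  by (simp add: qfac_def)

lemma qfac_add: "qfac x (m + n) = qfac x m * qfac (x * q ^ m) n"
  by (induction n) (simp_all add: qfac_Suc power_add mult.assoc)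

lemma qfac_Suc': "qfac x (Suc n) = (1 - x) * qfac (x * q) n"
  using qfac_add[of x 1 n] by (simp add: qfac_def)

lemma qfac_split: "m \<le> n \<Longrightarrow> qfac x n = qfac x m * qfac (x * q ^ m) (n - m)"
  using qfac_add[of x m "n - m"] by simp

lemma qfac_nonzero_iff: "qfac x n \<noteq> 0 \<longleftrightarrow> (\<forall>j<n. x * q ^ j \<noteq> 1)"
  by (auto simp: qfac_def)

lemma qfac_nonzero_mono: "qfac x n \<noteq> 0 \<Longrightarrow> m \<le> n \<Longrightarrow> qfac x m \<noteq> 0"
  by (auto simp: qfac_nonzero_iff)

lemma qfac_q_nonzero [simp]: "qfac q n \<noteq> 0"
  using q_power_neq_1[of "Suc _"] by (auto simp: qfac_nonzero_iff)

lemma qfac_inverse_power_eq_0: "n < k \<Longrightarrow> qfac (1 / q ^ n) k = 0"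
  using q_nonzero by (auto simp: qfac_def intro!: bexI[of _ n])

lemma rev_factor_eq: "rev_factor x n = (- x) ^ n * (\<Prod>j<n. q ^ j)"
  by (simp add: rev_factor_def prod.distrib flip: mult_minus_left)

lemma rev_factor_nonzero: "x \<noteq> 0 \<Longrightarrow> rev_factor x n \<noteq> 0"
  using q_nonzero by (simp add: rev_factor_def)

text \<open>Factor \<open>j\<close> of \<open>(x;q)_n\<close> is matched with factor
  \<open>n - 1 - j\<close> of \<open>(y;q)_n\<close>: there the product of \<open>x * q ^ j\<close>
  and \<open>y * q ^ (n - 1 - j)\<close> is 1, and \<open>1 - u = -u (1 - 1/u)\<close>.\<close>

lemma qfac_reverse:
  assumes "x * y * q ^ n = q"
  shows "qfac x n = rev_factor x n * qfac y n"
proof -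
  have "qfac y n = (\<Prod>j<n. 1 - y * q ^ (n - Suc j))"
    unfolding qfac_def by (rule prod.nat_diff_reindex[symmetric])
  then have "rev_factor x n * qfac y n = (\<Prod>j<n. - (x * q ^ j) * (1 - y * q ^ (n - Suc j)))"
    by (simp only: rev_factor_def prod.distrib)
  also have "\<dots> = qfac x n"
    unfolding qfac_def
  proof (rule prod.cong)
    fix j assume "j \<in> {..<n}"
    then have "q ^ n = q * q ^ j * q ^ (n - Suc j)"
      by (simp flip: power_add power_Suc)
    with assms have "q * (x * q ^ j * (y * q ^ (n - Suc j))) = q * 1"
      by (simp add: mult_ac)
    then have "x * q ^ j * (y * q ^ (n - Suc j)) = 1"
      using q_nonzero by (metis mult_cancel_left)
    then show "- (x * q ^ j) * (1 - y * q ^ (n - Suc j)) = 1 - x * q ^ j"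
      by (simp add: algebra_simps)
  qed simp
  finally show ?thesis ..
qed

lemma vw_0 [simp]: "vw a 0 = 1"
  by (simp add: vw_def)

lemma vw_mult: "(1 - a) * vw a n = qfac a n * (1 - a * q ^ (2 * n))"
proof (cases n)
  case (Suc k)
  then show ?thesis
    by (simp add: vw_def qfac_Suc')
qed (simp add: vw_def)

lemma isCont_qfac [continuous_intros]: "isCont f x \<Longrightarrow> isCont (\<lambda>t. qfac (f t) n) x"
  unfolding qfac_def by (intro continuous_intros)

lemma isCont_vw [continuous_intros]: "isCont f x \<Longrightarrow> isCont (\<lambda>t. vw (f t) n) x"
  unfolding vw_def by (cases "n = 0") (auto intro!: continuous_intros)

lemma isCont_rev_factor [continuous_intros]:
  "isCont f x \<Longrightarrow> isCont (\<lambda>t. rev_factor (f t) n) x"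
  unfolding rev_factor_def by (intro continuous_intros)

section \<open>Jackson's summation formula\<close>

text \<open>For \<open>z = a \<noteq> 0\<close> this is \<open>(a;q)_n / (q;q)_n\<close>, so the
  leading pair of a well-poised series has the same shape as all others.\<close>

definition wp_quot :: "complex \<Rightarrow> complex \<Rightarrow> nat \<Rightarrow> complex" where
  "wp_quot a z n = qfac z n / qfac (a * q / z) n"

lemma wp_quot_Suc:
  assumes "a * q ^ Suc k / z \<noteq> 1"
  shows "wp_quot a z (Suc k) * (1 - a * q ^ Suc k / z) = wp_quot a z k * (1 - z * q ^ k)"
proof -
  have "wp_quot a z (Suc k) = qfac z k * (1 - z * q ^ k) / (qfac (a * q / z) k * (1 - a * q ^ Suc k / z))"
    by (simp add: wp_quot_def qfac_Suc mult_ac)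
  with assms show ?thesis
    by (simp add: wp_quot_def del: power_Suc)
qed

text \<open>The two extra factors extend \<open>(z;q)_k\<close> at its end and shorten the
  denominator at its start, which amounts to moving the parameter from \<open>z\<close> to
  \<open>z * q\<close>. This produces the contiguous sums in the recursion.\<close>

lemma wp_quot_mult_q:
  assumes "z \<noteq> 0" "qfac (a / z) (Suc k) \<noteq> 0"
  shows "wp_quot a z k * ((1 - z * q ^ k) * (1 - a * q ^ k / z)) = (1 - z) * (1 - a / z) * wp_quot a (z * q) k"
proof -
  have "qfac (a / z) k * (1 - a * q ^ k / z) = (1 - a / z) * qfac (a * q / z) k"
    using qfac_Suc[of "a / z" k] qfac_Suc'[of "a / z" k] by simp
  moreover have "qfac z k * (1 - z * q ^ k) = (1 - z) * qfac (z * q) k"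
    using qfac_Suc[of z k] qfac_Suc'[of z k] by simp
  moreover have "qfac (a / z) k \<noteq> 0" "qfac (a * q / z) k \<noteq> 0"
    using assms qfac_Suc[of "a / z" k] qfac_Suc'[of "a / z" k] by auto
  moreover have "wp_quot a (z * q) k = qfac (z * q) k / qfac (a / z) k"
    using q_nonzero by (simp add: wp_quot_def)
  moreover have "p / r * (B * A) = Z * C * (s / t)"
    if "t * A = C * r" "p * B = Z * s" "t \<noteq> 0" "r \<noteq> 0" for p r s t A B C Z :: complex
    using that by (simp add: divide_simps) algebra
  ultimately show ?thesis
    by (simp add: wp_quot_def)
qed

text \<open>The first product at \<open>k\<close> equals the second at \<open>k + 1\<close>, once
  the quotients are included. The lower end vanishes because of \<open>1 - q ^ 0\<close>, the upper
  one because of \<open>1 - y * q ^ n\<close>.\<close>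

lemma well_poised_telescoping:
  assumes gen: "\<And>z k. z \<in> {b, c, d, x, y} \<Longrightarrow> k < n \<Longrightarrow> a * q ^ Suc k / z \<noteq> 1"
    and a: "a \<noteq> 0" and y: "y * q ^ n = 1"
  shows "(\<Sum>k\<le>n. wp_quot a a k * wp_quot a b k * wp_quot a c k * wp_quot a d k * wp_quot a x k * wp_quot a y k *
      ((1 - a * q ^ k) * (1 - b * q ^ k) * (1 - c * q ^ k) * (1 - d * q ^ k)
         * (1 - x * q ^ k) * (1 - y * q ^ k)
     - (1 - q ^ k) * (1 - a * q ^ k / b) * (1 - a * q ^ k / c) * (1 - a * q ^ k / d)
         * (1 - a * q ^ k / x) * (1 - a * q ^ k / y))) = 0"
proof -
  define g where "g k = wp_quot a a k * wp_quot a b k * wp_quot a c k * wp_quot a d k * wp_quot a x k * wp_quot a y k *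
     ((1 - q ^ k) * (1 - a * q ^ k / b) * (1 - a * q ^ k / c) * (1 - a * q ^ k / d)
         * (1 - a * q ^ k / x) * (1 - a * q ^ k / y))" for k
  define h where "h k = wp_quot a a k * wp_quot a b k * wp_quot a c k * wp_quot a d k * wp_quot a x k * wp_quot a y k *
     ((1 - a * q ^ k) * (1 - b * q ^ k) * (1 - c * q ^ k) * (1 - d * q ^ k)
         * (1 - x * q ^ k) * (1 - y * q ^ k))" for k
  have gh: "g (Suc k) = h k" if "k < n" for k
  proof -
    have "wp_quot a a (Suc k) * (1 - q ^ Suc k) = wp_quot a a k * (1 - a * q ^ k)"
      using wp_quot_Suc[of a k a] q_power_neq_1[of "Suc k"] a by simp
    with gen[of b k] gen[of c k] gen[of d k] gen[of x k] gen[of y k] that show ?thesis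
      unfolding g_def h_def
      using wp_quot_Suc[of a k b] wp_quot_Suc[of a k c] wp_quot_Suc[of a k d] wp_quot_Suc[of a k x] wp_quot_Suc[of a k y]
      by (simp add: mult_ac del: power_Suc)
        (smt (verit) mult.assoc mult.commute mult.left_commute)
  qed
  have "(\<Sum>k\<le>n. h k - g k) = h n - g 0"
    using gh
  proof (induction n)
    case (Suc n)
    then show ?case by simp
  qed simp
  also have "g 0 = 0"
    by (simp add: g_def)
  also have "h n = 0"
    by (simp add: h_def y)
  finally show ?thesis
    by (simp only: g_def h_def diff_self flip: right_diff_distrib)
qed

text \<open>The fifth parameter is forced by balancing: the product of \<open>b\<close>,
  \<open>c\<close>, \<open>d\<close>, this parameter and \<open>q^-N\<close> is
  \<open>a^2 q\<close>.\<close>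

definition jackson_sum :: "complex \<Rightarrow> complex \<Rightarrow> complex \<Rightarrow> complex \<Rightarrow> nat \<Rightarrow> complex" where
  "jackson_sum a b c d N = (\<Sum>k\<le>N. vw a k / qfac q k * (wp_quot a b k * wp_quot a c k * wp_quot a d k)
     * (wp_quot a (a\<^sup>2 * q ^ (N + 1) / (b * c * d)) k * wp_quot a (1 / q ^ N) k) * q ^ k)"

text \<open>The last two parameters are \<open>(x, y * q)\<close> in the sum for \<open>N\<close>
  and \<open>(x * q, y)\<close> in the sum for \<open>N + 1\<close>. In between lies the telescoping
  sum with \<open>(x, y)\<close>, whose parameters satisfy \<open>b * c * d * x * y = a^2\<close>;
  \<open>six_parameter_identity\<close> writes \<open>x - y\<close> times its terms as a combination
  of terms of the two neighbours.\<close>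

lemma jackson_sum_Suc:
  assumes nz: "a \<noteq> 0" "b \<noteq> 0" "c \<noteq> 0" "d \<noteq> 0"
    and gen: "\<And>j. j \<le> 2 * (N + 1) \<Longrightarrow> a * q ^ j \<notin> {1, b, c, d, b * c * d}"
  defines "x \<equiv> a\<^sup>2 * q ^ (N + 1) / (b * c * d)" and "y \<equiv> 1 / q ^ Suc N"
  shows "y\<^sup>2 * (1 - 1 / y) * (1 - a / (b * y)) * (1 - a / (c * y)) * (1 - a / (d * y))
           * (1 - x) * (1 - a / x) * jackson_sum a b c d (Suc N)
       = x\<^sup>2 * (1 - 1 / x) * (1 - a / (b * x)) * (1 - a / (c * x)) * (1 - a / (d * x))
           * (1 - y) * (1 - a / y) * jackson_sum a b c d N"
proof -
  define \<alpha> where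
    "\<alpha> = y\<^sup>2 * (1 - 1 / y) * (1 - a / (b * y)) * (1 - a / (c * y)) * (1 - a / (d * y))"
  define \<beta> where
    "\<beta> = x\<^sup>2 * (1 - 1 / x) * (1 - a / (b * x)) * (1 - a / (c * x)) * (1 - a / (d * x))"
  define W where "W k = wp_quot a b k * wp_quot a c k * wp_quot a d k" for k
  have xy: "x \<noteq> 0" "y \<noteq> 0"
    using nz q_nonzero by (auto simp: x_def y_def)
  have bal: "b * c * d * x * y = a\<^sup>2"
    using nz q_nonzero by (simp add: x_def y_def)
  have ax: "a / x * q ^ j \<noteq> 1" if "j \<le> N + 1" for j
  proof
    assume "a / x * q ^ j = 1"
    then have "b * c * d * q ^ j = a * q ^ (N + 1)"
      using nz q_nonzero by (simp add: x_def divide_simps power2_eq_square mult.assoc split: if_splits)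
    moreover have "q ^ (N + 1) = q ^ (N + 1 - j) * q ^ j"
      using that by (simp flip: power_add)
    ultimately have "a * q ^ (N + 1 - j) = b * c * d"
      by (simp add: mult.assoc)
    moreover have "N + 1 - j \<le> 2 * (N + 1)"
      by simp
    ultimately show False
      using gen by blast
  qed
  have ay: "a / y * q ^ j \<noteq> 1" if "j \<le> N + 1" for j
    using gen[of "N + 1 + j"] that by (simp add: y_def power_add mult_ac)
  have Pax: "qfac (a / x) (Suc k) \<noteq> 0" and Pay: "qfac (a / y) (Suc k) \<noteq> 0" if "k \<le> N + 1" for k
    using ax ay that by (auto simp: qfac_nonzero_iff)
  have "(\<Sum>k\<le>Suc N. wp_quot a a k * wp_quot a b k * wp_quot a c k * wp_quot a d k * wp_quot a x k * wp_quot a y k *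
      ((1 - a * q ^ k) * (1 - b * q ^ k) * (1 - c * q ^ k) * (1 - d * q ^ k)
         * (1 - x * q ^ k) * (1 - y * q ^ k)
     - (1 - q ^ k) * (1 - a * q ^ k / b) * (1 - a * q ^ k / c) * (1 - a * q ^ k / d)
         * (1 - a * q ^ k / x) * (1 - a * q ^ k / y))) = 0"
  proof (rule well_poised_telescoping)
    fix z k assume z: "z \<in> {b, c, d, x, y}" and k: "k < Suc N"
    have "a * q ^ Suc k \<noteq> b" "a * q ^ Suc k \<noteq> c" "a * q ^ Suc k \<noteq> d"
      using gen[of "Suc k"] k by auto
    moreover have "a * q ^ Suc k \<noteq> x" "a * q ^ Suc k \<noteq> y"
      using ax[of "Suc k"] ay[of "Suc k"] k xy by (auto simp: divide_simps)
    ultimately show "a * q ^ Suc k / z \<noteq> 1"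
      using z nz xy by (auto simp: divide_simps simp del: power_Suc)
  qed (use nz q_nonzero in \<open>auto simp: y_def\<close>)
  note telescoped = this
  have "0 = (x - y) * (\<Sum>k\<le>Suc N. wp_quot a a k * wp_quot a b k * wp_quot a c k * wp_quot a d k * wp_quot a x k * wp_quot a y k *
      ((1 - a * q ^ k) * (1 - b * q ^ k) * (1 - c * q ^ k) * (1 - d * q ^ k)
         * (1 - x * q ^ k) * (1 - y * q ^ k)
     - (1 - q ^ k) * (1 - a * q ^ k / b) * (1 - a * q ^ k / c) * (1 - a * q ^ k / d)
         * (1 - a * q ^ k / x) * (1 - a * q ^ k / y)))" (is "_ = _ * sum ?f _")
    unfolding telescoped by simp
  also have "\<dots> = (\<Sum>k\<le>Suc N. (1 - a) * (vw a k / qfac q k * W k * q ^ k *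
     (\<alpha> * (1 - x) * (1 - a / x) * (wp_quot a (x * q) k * wp_quot a y k)
    - \<beta> * (1 - y) * (1 - a / y) * (wp_quot a x k * wp_quot a (y * q) k))))"
    unfolding sum_distrib_left
  proof (rule sum.cong)
    fix k assume "k \<in> {..Suc N}"
    then have k: "k \<le> N + 1" by simp
    have "(x - y) * ?f k = wp_quot a a k * W k * wp_quot a x k * wp_quot a y k *
      ((x - y) * ((1 - a * q ^ k) * (1 - b * q ^ k) * (1 - c * q ^ k) * (1 - d * q ^ k)
         * (1 - x * q ^ k) * (1 - y * q ^ k)
     - (1 - q ^ k) * (1 - a * q ^ k / b) * (1 - a * q ^ k / c) * (1 - a * q ^ k / d)
         * (1 - a * q ^ k / x) * (1 - a * q ^ k / y)))"
      by (simp only: W_def mult_ac)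
    also have "\<dots> = wp_quot a a k * W k * wp_quot a x k * wp_quot a y k * (q ^ k * (1 - a * (q ^ k)\<^sup>2) *
        (\<alpha> * ((1 - x * q ^ k) * (1 - a * q ^ k / x)) - \<beta> * ((1 - y * q ^ k) * (1 - a * q ^ k / y))))"
      unfolding \<alpha>_def \<beta>_def
      using six_parameter_identity[OF nz xy bal, of "q ^ k"] by simp
    also have "\<dots> = wp_quot a a k * (1 - a * (q ^ k)\<^sup>2) * W k * q ^ k *
        (\<alpha> * (wp_quot a x k * ((1 - x * q ^ k) * (1 - a * q ^ k / x))) * wp_quot a y k
       - \<beta> * (wp_quot a y k * ((1 - y * q ^ k) * (1 - a * q ^ k / y))) * wp_quot a x k)"
      by (simp only: right_diff_distrib[where b = "_ * _"] mult_ac)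
    also have "wp_quot a a k * (1 - a * (q ^ k)\<^sup>2) = (1 - a) * (vw a k / qfac q k)"
      using vw_mult[of a k] nz by (simp add: wp_quot_def power_mult[symmetric] mult.commute)
    also have "wp_quot a x k * ((1 - x * q ^ k) * (1 - a * q ^ k / x)) = (1 - x) * (1 - a / x) * wp_quot a (x * q) k"
      by (rule wp_quot_mult_q[OF xy(1) Pax[OF k]])
    also have "wp_quot a y k * ((1 - y * q ^ k) * (1 - a * q ^ k / y)) = (1 - y) * (1 - a / y) * wp_quot a (y * q) k"
      by (rule wp_quot_mult_q[OF xy(2) Pay[OF k]])
    finally show "(x - y) * ?f k = (1 - a) * (vw a k / qfac q k * W k * q ^ k *
     (\<alpha> * (1 - x) * (1 - a / x) * (wp_quot a (x * q) k * wp_quot a y k)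
    - \<beta> * (1 - y) * (1 - a / y) * (wp_quot a x k * wp_quot a (y * q) k)))"
      by (simp only: mult_ac)
  qed simp
  also have "\<dots> = (1 - a) * (\<alpha> * (1 - x) * (1 - a / x)
        * (\<Sum>k\<le>Suc N. vw a k / qfac q k * W k * (wp_quot a (x * q) k * wp_quot a y k) * q ^ k)
     - \<beta> * (1 - y) * (1 - a / y)
        * (\<Sum>k\<le>Suc N. vw a k / qfac q k * W k * (wp_quot a x k * wp_quot a (y * q) k) * q ^ k))"
    unfolding sum_distrib_left sum_subtractf[symmetric]
    by (intro sum.cong refl) (simp only: right_diff_distrib[where b = "_ * _"] mult_ac)
  also have "(\<Sum>k\<le>Suc N. vw a k / qfac q k * W k * (wp_quot a (x * q) k * wp_quot a y k) * q ^ k)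
      = jackson_sum a b c d (Suc N)"
    by (simp only: jackson_sum_def W_def x_def y_def) (simp add: mult_ac)
  \<comment> \<open>The extra term \<open>k = N + 1\<close> contains
    \<open>(q^-N;q)_(N+1) = 0\<close>.\<close>
  also have "(\<Sum>k\<le>Suc N. vw a k / qfac q k * W k * (wp_quot a x k * wp_quot a (y * q) k) * q ^ k)
      = jackson_sum a b c d N"
  proof -
    have yq: "y * q = 1 / q ^ N"
      using q_nonzero by (simp add: y_def)
    moreover have "wp_quot a (1 / q ^ N) (Suc N) = 0"
      by (simp add: wp_quot_def qfac_inverse_power_eq_0)
    ultimately show ?thesis
      by (simp add: jackson_sum_def W_def x_def)
  qed
  \<comment> \<open>\<open>gen\<close> at \<open>j = 0\<close> gives \<open>a \<noteq> 1\<close>,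
    which cancels the common factor \<open>1 - a\<close>.\<close>
  finally show ?thesis
    using gen[of 0] by (simp add: \<alpha>_def \<beta>_def)
qed

text \<open>Both sides obey the same first-order recursion in \<open>N\<close>, by
  \<open>jackson_sum_Suc\<close> and \<open>balanced_ratio\<close>. For fixed \<open>b\<close>,
  \<open>c\<close>, \<open>d\<close>, \<open>N\<close> the genericity conditions exclude only
  finitely many \<open>a\<close>, so a limit can remove them afterwards.\<close>

lemma jackson_generic:
  assumes nz: "a \<noteq> 0" "b \<noteq> 0" "c \<noteq> 0" "d \<noteq> 0"
    and gen: "\<And>j. j \<le> 2 * N \<Longrightarrow> a * q ^ j \<notin> {1, b, c, d, b * c * d} \<and> a\<^sup>2 * q ^ j \<noteq> b * c * d"
  shows "jackson_sum a b c d N * (qfac (a * q / b) N * qfac (a * q / c) N * qfac (a * q / d) N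
           * qfac (a * q / (b * c * d)) N)
       = qfac (a * q) N * qfac (a * q / (b * c)) N * qfac (a * q / (b * d)) N * qfac (a * q / (c * d)) N"
  using gen
proof (induction N)
  case 0
  then show ?case by (simp add: jackson_sum_def wp_quot_def)
next
  case (Suc N)
  define x y where "x = a\<^sup>2 * q ^ (N + 1) / (b * c * d)" and "y = 1 / q ^ Suc N"
  define D where "D n = qfac (a * q / b) n * qfac (a * q / c) n * qfac (a * q / d) n
    * qfac (a * q / (b * c * d)) n" for n
  define R where "R n = qfac (a * q) n * qfac (a * q / (b * c)) n * qfac (a * q / (b * d)) n
    * qfac (a * q / (c * d)) n" for n
  define \<delta> where "\<delta> = (1 - a / (b * y)) * (1 - a / (c * y)) * (1 - a / (d * y))"
  define \<alpha> where "\<alpha> = y\<^sup>2 * (1 - 1 / y) * (1 - x) * (1 - a / x)"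
  define \<beta> where
    "\<beta> = x\<^sup>2 * (1 - 1 / x) * (1 - a / (b * x)) * (1 - a / (c * x)) * (1 - a / (d * x)) * (1 - y)"
  have xy: "x \<noteq> 0" "y \<noteq> 0"
    using nz q_nonzero by (auto simp: x_def y_def)
  have bal: "b * c * d * x * y = a\<^sup>2"
    using nz q_nonzero by (simp add: x_def y_def)
  have IH: "jackson_sum a b c d N * D N = R N"
    using Suc unfolding D_def R_def by auto
  have rec: "\<delta> * \<alpha> * jackson_sum a b c d (Suc N) = \<beta> * (1 - a / y) * jackson_sum a b c d N"
    using jackson_sum_Suc[OF nz, of N] Suc.prems
    unfolding x_def[symmetric] y_def[symmetric] \<alpha>_def \<beta>_def \<delta>_def by (simp add: mult_ac)
  have D: "D (Suc N) = D N * \<delta> * (1 - a / (b * c * d * y))"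
    by (simp add: D_def \<delta>_def y_def qfac_Suc mult_ac)
  have R: "R (Suc N) = R N * (1 - a / y) *
      ((1 - a / (b * c * y)) * (1 - a / (b * d * y)) * (1 - a / (c * d * y)))"
    by (simp add: R_def y_def qfac_Suc mult_ac)
  have ratio: "\<beta> * (1 - a / (b * c * d * y)) = \<alpha> * ((1 - a / (b * c * y)) * (1 - a / (b * d * y)) * (1 - a / (c * d * y)))"
    using balanced_ratio[OF nz xy bal] unfolding \<alpha>_def \<beta>_def by (simp only: mult.assoc)
  \<comment> \<open>Here the recursion is solved for the longer sum. The factor \<open>1 - x\<close>
    is the reason for the condition on \<open>a\<^sup>2 * q ^ j\<close>.\<close>
  have "\<alpha> \<noteq> 0"
  proof -
    have "1 / y \<noteq> 1"
      using q_power_neq_1[of "Suc N"] by (simp add: y_def)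
    moreover have "x \<noteq> 1"
      using Suc.prems[of "N + 1"] nz by (auto simp: x_def divide_simps)
    moreover have "a / x \<noteq> 1"
      using Suc.prems[of "N + 1"] nz q_nonzero by (auto simp: x_def divide_simps power2_eq_square mult.assoc)
    ultimately show ?thesis
      using xy by (auto simp: \<alpha>_def)
  qed
  have "\<alpha> * (jackson_sum a b c d (Suc N) * D (Suc N))
      = (\<delta> * \<alpha> * jackson_sum a b c d (Suc N)) * (1 - a / (b * c * d * y)) * D N"
    by (simp only: D mult_ac)
  also have "\<dots> = (\<beta> * (1 - a / (b * c * d * y))) * (1 - a / y) * (jackson_sum a b c d N * D N)"
    unfolding rec by (simp only: mult_ac)
  also have "\<dots> = \<alpha> * R (Suc N)"
    unfolding ratio IH R by (simp only: mult_ac)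
  finally show ?case
    using \<open>\<alpha> \<noteq> 0\<close> by (simp add: D_def R_def)
qed

section \<open>Removing genericity from Jackson's formula\<close>

lemma wp_quot_mult_qfac:
  assumes "qfac (a * q / z) N \<noteq> 0" "k \<le> N"
  shows "wp_quot a z k * qfac (a * q / z) N = qfac z k * qfac (a * q / z * q ^ k) (N - k)"
  using assms qfac_nonzero_mono[OF assms] by (simp add: wp_quot_def qfac_split[OF assms(2)])

text \<open>
  The terminating series multiplied by its denominators. In the inner sum over \<open>m\<close>, the denominators
  \<open>(aq\<^sup>1\<^sup>-\<^sup>n/A; q)\<^sub>m\<close> are allowed to vanish, so that Jackson's formula is needed in this form; it extends
  from generic \<open>a\<close> to all \<open>a\<close> by continuity.
\<close>

definition cleared_sum :: "complex \<Rightarrow> complex \<Rightarrow> complex \<Rightarrow> complex \<Rightarrow> nat \<Rightarrow> complex" where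
  "cleared_sum a b c d N = (\<Sum>k\<le>N. vw a k / qfac q k
     * (qfac b k * qfac (a * q / b * q ^ k) (N - k) * (qfac c k * qfac (a * q / c * q ^ k) (N - k))
        * (qfac d k * qfac (a * q / d * q ^ k) (N - k)))
     * (qfac (a\<^sup>2 * q ^ (N + 1) / (b * c * d)) k * qfac (b * c * d / (a * q ^ N) * q ^ k) (N - k)
        * (qfac (1 / q ^ N) k * qfac (a * q ^ (N + 1) * q ^ k) (N - k))) * q ^ k)"

lemma jackson_sum_mult:
  assumes nz: "a \<noteq> 0" "b \<noteq> 0" "c \<noteq> 0" "d \<noteq> 0"
    and den: "qfac (a * q / b) N \<noteq> 0" "qfac (a * q / c) N \<noteq> 0" "qfac (a * q / d) N \<noteq> 0"
      "qfac (b * c * d / (a * q ^ N)) N \<noteq> 0" "qfac (a * q ^ (N + 1)) N \<noteq> 0"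
  shows "jackson_sum a b c d N * (qfac (a * q / b) N * qfac (a * q / c) N * qfac (a * q / d) N
      * qfac (b * c * d / (a * q ^ N)) N * qfac (a * q ^ (N + 1)) N) = cleared_sum a b c d N"
  unfolding jackson_sum_def cleared_sum_def sum_distrib_right
proof (rule sum.cong)
  fix k assume "k \<in> {..N}"
  then have k: "k \<le> N" by simp
  define e where "e = a\<^sup>2 * q ^ (N + 1) / (b * c * d)"
  have e: "a * q / e = b * c * d / (a * q ^ N)"
    using nz by (simp add: e_def power2_eq_square)
  have f: "a * q / (1 / q ^ N) = a * q ^ (N + 1)"
    by simp
  have quots: "wp_quot a b k * qfac (a * q / b) N = qfac b k * qfac (a * q / b * q ^ k) (N - k)"
    "wp_quot a c k * qfac (a * q / c) N = qfac c k * qfac (a * q / c * q ^ k) (N - k)"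
    "wp_quot a d k * qfac (a * q / d) N = qfac d k * qfac (a * q / d * q ^ k) (N - k)"
    "wp_quot a e k * qfac (b * c * d / (a * q ^ N)) N = qfac e k * qfac (b * c * d / (a * q ^ N) * q ^ k) (N - k)"
    "wp_quot a (1 / q ^ N) k * qfac (a * q ^ (N + 1)) N
       = qfac (1 / q ^ N) k * qfac (a * q ^ (N + 1) * q ^ k) (N - k)"
    using wp_quot_mult_qfac[OF den(1) k] wp_quot_mult_qfac[OF den(2) k] wp_quot_mult_qfac[OF den(3) k]
      wp_quot_mult_qfac[of a e, OF _ k, unfolded e, OF den(4)]
      wp_quot_mult_qfac[of a "1 / q ^ N", OF _ k, unfolded f, OF den(5)]
    by simp_all
  show "vw a k / qfac q k * (wp_quot a b k * wp_quot a c k * wp_quot a d k) * (wp_quot a e k * wp_quot a (1 / q ^ N) k) * q ^ k *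
      (qfac (a * q / b) N * qfac (a * q / c) N * qfac (a * q / d) N
      * qfac (b * c * d / (a * q ^ N)) N * qfac (a * q ^ (N + 1)) N) =
     vw a k / qfac q k
     * (qfac b k * qfac (a * q / b * q ^ k) (N - k) * (qfac c k * qfac (a * q / c * q ^ k) (N - k))
        * (qfac d k * qfac (a * q / d * q ^ k) (N - k)))
     * (qfac e k * qfac (b * c * d / (a * q ^ N) * q ^ k) (N - k)
        * (qfac (1 / q ^ N) k * qfac (a * q ^ (N + 1) * q ^ k) (N - k))) * q ^ k"
    unfolding quots[symmetric] by (simp only: mult_ac)
qed simp

text \<open>Relates the denominator that belongs to the balancing parameter to the factor
  \<open>(aq/(bcd);q)_N\<close> in Jackson's formula.\<close>

lemma qfac_reverse_balanced:
  assumes "a \<noteq> 0" "b \<noteq> 0" "c \<noteq> 0" "d \<noteq> 0"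
  shows "qfac (b * c * d / (a * q ^ N)) N
    = rev_factor (b * c * d / (a * q ^ N)) N * qfac (a * q / (b * c * d)) N"
  using assms by (intro qfac_reverse) simp

lemma qfac_double: "qfac (a * q) (2 * N) = qfac (a * q) N * qfac (a * q ^ (N + 1)) N"
  using qfac_add[of "a * q" N N] by (simp add: mult_2 mult.assoc)

text \<open>Each \<open>j\<close> excludes finitely many points: the quotients
  \<open>s / q ^ j\<close> with \<open>s\<close> in \<open>S\<close>, and the square roots of
  \<open>w / q ^ j\<close>.\<close>

lemma eventually_generic:
  assumes "finite S"
  shows "\<forall>\<^sub>F t in at (a :: complex). t \<noteq> 0 \<and>
    (\<forall>j\<le>L. t * q ^ j \<notin> S \<and> t\<^sup>2 * q ^ j \<noteq> w)"
proof -
  have 1: "\<forall>\<^sub>F t in at a. t * q ^ j \<notin> S" for j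
  proof -
    have "\<forall>\<^sub>F t in at a. \<forall>s\<in>S. t \<noteq> s / q ^ j"
      using assms by (intro eventually_ball_finite ballI eventually_neq_at_within)
    then show ?thesis
      by eventually_elim (auto simp: divide_simps)
  qed
  have 2: "\<forall>\<^sub>F t in at a. t\<^sup>2 * q ^ j \<noteq> w" for j
  proof -
    define s where "s = csqrt (w / q ^ j)"
    have "\<forall>\<^sub>F t in at a. t \<noteq> s \<and> t \<noteq> - s"
      by (intro eventually_conj eventually_neq_at_within)
    then show ?thesis
    proof eventually_elim
      case (elim t)
      then have "t\<^sup>2 \<noteq> s\<^sup>2"
        by (simp add: power2_eq_iff)
      then show ?case
        by (auto simp: s_def divide_simps)
    qed
  qed
  have "\<forall>\<^sub>F t in at a. \<forall>j\<in>{..L}. t * q ^ j \<notin> S \<and> t\<^sup>2 * q ^ j \<noteq> w"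
    by (intro eventually_ball_finite ballI eventually_conj 1 2) simp
  then show ?thesis
    using eventually_neq_at_within[of 0 a UNIV] by eventually_elim auto
qed

text \<open>The length \<open>2 * N\<close> arises because \<open>(aq;q)_N\<close> from Jackson's
  formula is continued by \<open>(aq^(N+1);q)_N\<close>, the cleared denominator belonging to
  \<open>q^-N\<close>. The \<open>rev_factor\<close> is left over from the balancing parameter's
  denominator.\<close>

lemma jackson_cleared:
  assumes nz: "a \<noteq> 0" "b \<noteq> 0" "c \<noteq> 0" "d \<noteq> 0"
  shows "cleared_sum a b c d N = qfac (a * q) (2 * N) * qfac (a * q / (b * c)) N * qfac (a * q / (b * d)) N
     * qfac (a * q / (c * d)) N * rev_factor (b * c * d / (a * q ^ N)) N"
proof -
  define rhs where "rhs t = qfac (t * q) (2 * N) * qfac (t * q / (b * c)) N * qfac (t * q / (b * d)) N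
     * qfac (t * q / (c * d)) N * rev_factor (b * c * d / (t * q ^ N)) N" for t
  have fin: "finite {1, b, c, d, b * c * d}"
    by simp
  have "\<forall>\<^sub>F t in at a. cleared_sum t b c d N = rhs t"
    using eventually_generic[OF fin, where a = a and L = "2 * N" and w = "b * c * d"]
  proof eventually_elim
    case (elim t)
    then have t: "t \<noteq> 0" by simp
    have gen: "t * q ^ j \<notin> {1, b, c, d, b * c * d} \<and> t\<^sup>2 * q ^ j \<noteq> b * c * d" if "j \<le> 2 * N" for j
      using elim that by blast
    have den: "qfac (t * q / b) N \<noteq> 0" "qfac (t * q / c) N \<noteq> 0" "qfac (t * q / d) N \<noteq> 0"
      using gen[of "Suc _"] nz by (auto simp: qfac_nonzero_iff divide_simps mult.assoc)
    have den4: "qfac (b * c * d / (t * q ^ N)) N \<noteq> 0"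
      unfolding qfac_nonzero_iff
    proof (intro allI impI notI)
      fix j assume j: "j < N" and "b * c * d / (t * q ^ N) * q ^ j = 1"
      then have "b * c * d * q ^ j = t * q ^ N"
        using t by (simp add: divide_simps)
      also have "q ^ N = q ^ (N - j) * q ^ j"
        using j by (simp flip: power_add)
      finally have "t * q ^ (N - j) = b * c * d"
        by (simp add: mult.assoc)
      moreover have "N - j \<le> 2 * N"
        by simp
      ultimately show False
        using gen by blast
    qed
    have den5: "qfac (t * q ^ (N + 1)) N \<noteq> 0"
      unfolding qfac_nonzero_iff
    proof (intro allI impI)
      fix j assume "j < N"
      then show "t * q ^ (N + 1) * q ^ j \<noteq> 1"
        using gen[of "N + 1 + j"] by (simp add: power_add mult_ac)
    qed
    have gen_sum: "jackson_sum t b c d N * (qfac (t * q / b) N * qfac (t * q / c) N * qfac (t * q / d) N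
           * qfac (t * q / (b * c * d)) N)
       = qfac (t * q) N * qfac (t * q / (b * c)) N * qfac (t * q / (b * d)) N * qfac (t * q / (c * d)) N"
      by (rule jackson_generic[OF t nz(2-4)]) (rule gen)
    have "cleared_sum t b c d N = jackson_sum t b c d N * (qfac (t * q / b) N * qfac (t * q / c) N * qfac (t * q / d) N
      * qfac (t * q / (b * c * d)) N) * rev_factor (b * c * d / (t * q ^ N)) N * qfac (t * q ^ (N + 1)) N"
      unfolding jackson_sum_mult[OF t nz(2-4) den den4 den5, symmetric]
        qfac_reverse_balanced[OF t nz(2-4)] by (simp only: mult_ac)
    also have "\<dots> = rhs t"
      unfolding gen_sum qfac_double rhs_def by (simp only: mult_ac)
    finally show ?case .
  qed
  moreover have "isCont rhs a"
    unfolding rhs_def using nz by (intro continuous_intros) auto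
  moreover have "isCont (\<lambda>t. cleared_sum t b c d N) a"
    unfolding cleared_sum_def using nz by (intro continuous_intros) auto
  ultimately have "((\<lambda>t. cleared_sum t b c d N) \<longlongrightarrow> rhs a) (at a)"
    "((\<lambda>t. cleared_sum t b c d N) \<longlongrightarrow> cleared_sum a b c d N) (at a)"
    by (auto simp: isCont_def tendsto_cong)
  then have "cleared_sum a b c d N = rhs a"
    by (intro tendsto_unique[of "at a"]) auto
  then show ?thesis
    by (simp only: rhs_def)
qed

lemma jackson:
  assumes nz: "a \<noteq> 0" "b \<noteq> 0" "c \<noteq> 0" "d \<noteq> 0"
    and den: "qfac (a * q / b) N \<noteq> 0" "qfac (a * q / c) N \<noteq> 0" "qfac (a * q / d) N \<noteq> 0"
      "qfac (b * c * d / (a * q ^ N)) N \<noteq> 0" "qfac (a * q ^ (N + 1)) N \<noteq> 0"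
  shows "jackson_sum a b c d N * (qfac (a * q / b) N * qfac (a * q / c) N * qfac (a * q / d) N
           * qfac (a * q / (b * c * d)) N)
       = qfac (a * q) N * qfac (a * q / (b * c)) N * qfac (a * q / (b * d)) N * qfac (a * q / (c * d)) N"
proof -
  define r where "r = rev_factor (b * c * d / (a * q ^ N)) N * qfac (a * q ^ (N + 1)) N"
  have "r * (jackson_sum a b c d N * (qfac (a * q / b) N * qfac (a * q / c) N * qfac (a * q / d) N
           * qfac (a * q / (b * c * d)) N)) = cleared_sum a b c d N"
    unfolding jackson_sum_mult[OF nz den, symmetric] qfac_reverse_balanced[OF nz] r_def
    by (simp only: mult_ac)
  also have "\<dots> = r * (qfac (a * q) N * qfac (a * q / (b * c)) N * qfac (a * q / (b * d)) N * qfac (a * q / (c * d)) N)"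
    unfolding jackson_cleared[OF nz] qfac_double r_def by (simp only: mult_ac)
  finally show ?thesis
    using den nz by (simp add: r_def rev_factor_nonzero)
qed

section \<open>Connection coefficients\<close>

text \<open>\<open>(Aq;q)_(n-1)\<close> inside \<open>vw A n\<close> continues with
  \<open>(Aq^n;q)_m\<close> to \<open>(Aq;q)_(n+m-1)\<close>, which is then cut at
  \<open>2 * m\<close>. This makes term \<open>n\<close> in base \<open>A\<close> the term
  \<open>n - m\<close> in base \<open>A * q ^ (2 * m)\<close>.\<close>

lemma vw_shift:
  assumes "m \<le> n"
  shows "vw A n * qfac (A * q ^ n) m = qfac (A * q) (2 * m) * vw (A * q ^ (2 * m)) (n - m)"
proof (cases "n = 0")
  case False
  then obtain n' where n: "n = Suc n'"
    by (cases n) auto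
  have "vw A n * qfac (A * q ^ n) m = (1 - A * q ^ (2 * n)) * qfac (A * q) (n' + m)"
    by (simp add: vw_def n qfac_add mult.assoc)
  also have "\<dots> = qfac (A * q) (2 * m) * vw (A * q ^ (2 * m)) (n - m)"
  \<comment> \<open>For \<open>m = n\<close> the cut at \<open>2 * n\<close> lies one factor beyond
    \<open>(Aq;q)_(2n-1)\<close>; the very-well-poised factor \<open>1 - A * q ^ (2 * n)\<close> is
    exactly the missing one.\<close>
  proof (cases "m = n")
    case True
    have e: "2 * n = Suc (n' + m)"
      using n True by simp
    have "A * q * q ^ (n' + m) = A * q ^ (2 * n)"
      unfolding e by simp
    moreover have "qfac (A * q) (2 * n) = qfac (A * q) (n' + m) * (1 - A * q * q ^ (n' + m))"
      unfolding e by (rule qfac_Suc)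
    ultimately show ?thesis
      by (simp only: True diff_self_eq_0 vw_0 mult_1_left mult_1_right mult.commute)
  next
    case False
    with assms have "n' + m = 2 * m + (n - m - 1)" "2 * n = 2 * m + 2 * (n - m)" "n - m \<noteq> 0"
      using n by auto
    then show ?thesis
      using qfac_add[of "A * q" "2 * m" "n - m - 1"] by (simp add: vw_def power_add mult_ac)
  qed
  finally show ?thesis .
qed (use assms in simp)

lemma rev_factor_ratio: "y \<noteq> 0 \<Longrightarrow> rev_factor x n = (x / y) ^ n * rev_factor y n"
  by (simp add: rev_factor_eq power_mult_distrib[symmetric] mult.assoc[symmetric])

text \<open>Jackson's formula of length \<open>M - m\<close> in base \<open>A * q ^ (2 * m)\<close>.
  The parameters \<open>b\<close>, \<open>c\<close> are shifted by \<open>q ^ m\<close>, but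
  \<open>A / a\<close> is not: its partner is then \<open>a * q ^ (2 * m + 1)\<close>, the source of
  \<open>(aq;q)_(n+m)\<close>. Balancing makes the fifth parameter \<open>d * q ^ m\<close>.\<close>

lemma well_poised_expansion:
  assumes nz: "A \<noteq> 0" "a \<noteq> 0" "b \<noteq> 0" "c \<noteq> 0" and m: "m \<le> M"
    and d: "d = A * a * q ^ (M + 1) / (b * c)"
    and den: "qfac (A * q / b) M \<noteq> 0" "qfac (A * q / c) M \<noteq> 0" "qfac (b * c / (a * q ^ M)) M \<noteq> 0"
      "qfac (A * q ^ (M + 1)) M \<noteq> 0" "qfac (a * q) (M + m) \<noteq> 0" "qfac (a * q / (b * c)) M \<noteq> 0"
      "qfac (a * q / b) m \<noteq> 0" "qfac (a * q / c) m \<noteq> 0" "qfac (b * c / (A * q ^ M)) m \<noteq> 0"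
  shows "(\<Sum>n=m..M. vw A n * qfac (A * q ^ n) m * qfac (A / a) (n - m) / (qfac q (n - m) * qfac (a * q) (n + m))
      * (qfac b n * qfac c n * qfac d n * qfac (1 / q ^ M) n)
      / (qfac (A * q / b) n * qfac (A * q / c) n * qfac (b * c / (a * q ^ M)) n * qfac (A * q ^ (M + 1)) n)
      * q ^ (n - m))
    = qfac (A * q) M * qfac (a * q / b) M * qfac (a * q / c) M * qfac (A * q / (b * c)) M
      / (qfac (a * q) M * qfac (A * q / b) M * qfac (A * q / c) M * qfac (a * q / (b * c)) M)
      * ((qfac b m * qfac c m * qfac d m * qfac (1 / q ^ M) m)
      / (qfac (a * q / b) m * qfac (a * q / c) m * qfac (b * c / (A * q ^ M)) m * qfac (a * q ^ (M + 1)) m))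
      * (a / A) ^ m" (is "sum ?f _ = _")
proof -
  define K where "K = M - m"
  have M: "M = m + K"
    using m by (simp add: K_def)
  define A' b' c' d' where "A' = A * q ^ (2 * m)" and "b' = b * q ^ m" and "c' = c * q ^ m"
    and "d' = A / a"
  have nz': "A' \<noteq> 0" "b' \<noteq> 0" "c' \<noteq> 0" "d' \<noteq> 0"
    using nz by (auto simp: A'_def b'_def c'_def d'_def)
  have param: "A' * q / b' = A * q / b * q ^ m" "A' * q / c' = A * q / c * q ^ m"
    "A' * q / d' = a * q * q ^ (2 * m)" "b' * c' * d' / (A' * q ^ K) = b * c / (a * q ^ M) * q ^ m"
    "A' * q ^ (K + 1) = A * q ^ (M + 1) * q ^ m" "A' * q / (b' * c' * d') = a * q / (b * c)"
    "A' * q / (b' * c') = A * q / (b * c)" "A' * q / (b' * d') = a * q / b * q ^ m"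
    "A' * q / (c' * d') = a * q / c * q ^ m"
    "A'\<^sup>2 * q ^ (K + 1) / (b' * c' * d') = d * q ^ m"
    "1 / q ^ K = 1 / q ^ M * q ^ m"
    "A' * q / (d * q ^ m) = b * c / (a * q ^ M) * q ^ m"
    "A' * q / (1 / q ^ M * q ^ m) = A * q ^ (M + 1) * q ^ m"
    using nz by (simp_all add: A'_def b'_def c'_def d'_def d M power_add power_mult power2_eq_square mult_ac)
  have A'q: "A' * q = A * q * q ^ (2 * m)"
    by (simp add: A'_def)
  \<comment> \<open>The term \<open>n = m\<close>, by which all others are divided.\<close>
  define C where "C = qfac (A * q) (2 * m) * (qfac b m * qfac c m * qfac d m * qfac (1 / q ^ M) m)
     / (qfac (a * q) (2 * m) * qfac (A * q / b) m * qfac (A * q / c) m * qfac (b * c / (a * q ^ M)) m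
        * qfac (A * q ^ (M + 1)) m)"
  have spl: "qfac (A * q / b) M = qfac (A * q / b) m * qfac (A * q / b * q ^ m) K"
    "qfac (A * q / c) M = qfac (A * q / c) m * qfac (A * q / c * q ^ m) K"
    "qfac (b * c / (a * q ^ M)) M = qfac (b * c / (a * q ^ M)) m * qfac (b * c / (a * q ^ M) * q ^ m) K"
    "qfac (A * q ^ (M + 1)) M = qfac (A * q ^ (M + 1)) m * qfac (A * q ^ (M + 1) * q ^ m) K"
    "qfac (a * q / b) M = qfac (a * q / b) m * qfac (a * q / b * q ^ m) K"
    "qfac (a * q / c) M = qfac (a * q / c) m * qfac (a * q / c * q ^ m) K"
    using qfac_split[OF m] by (simp_all add: K_def)
  have spl': "qfac x M = qfac x K * qfac (x * q ^ K) m" for x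
    using qfac_add[of x K m] by (simp add: M add.commute)
  \<comment> \<open>Two ways of cutting \<open>(xq;q)_(M+m)\<close>: after \<open>2 * m\<close> and
    after \<open>M\<close> factors.\<close>
  have dbl: "qfac (x * q) (2 * m) * qfac (x * q * q ^ (2 * m)) K = qfac (x * q) M * qfac (x * q ^ (M + 1)) m" for x
  proof -
    have e: "2 * m + K = M + m"
      by (simp add: M)
    show ?thesis
      using qfac_add[of "x * q" "2 * m" K, unfolded e] qfac_add[of "x * q" M m] by (simp add: mult.assoc)
  qed
  have aq: "qfac (a * q) (2 * m) \<noteq> 0" "qfac (a * q * q ^ (2 * m)) K \<noteq> 0" "qfac (a * q) M \<noteq> 0" "qfac (a * q ^ (M + 1)) m \<noteq> 0"
    using den(5) qfac_add[of "a * q" M m] dbl[of a] by (auto simp: mult_ac)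
  have "sum ?f {m..M} = (\<Sum>k\<le>K. ?f (m + k))"
    using sum.shift_bounds_cl_nat_ivl[of ?f 0 m K] by (simp add: M atLeast0AtMost add.commute)
  also have "\<dots> = C * jackson_sum A' b' c' d' K"
    unfolding jackson_sum_def sum_distrib_left
  proof (rule sum.cong)
    fix k assume "k \<in> {..K}"
    have e: "m + k + m = 2 * m + k"
      by simp
    have e1: "vw A (m + k) * qfac (A * q ^ (m + k)) m = qfac (A * q) (2 * m) * vw A' k"
      using vw_shift[of m "m + k" A] by (simp add: A'_def)
    have e2: "qfac (a * q) (m + k + m) = qfac (a * q) (2 * m) * qfac (a * q * q ^ (2 * m)) k"
      unfolding e by (rule qfac_add)
    show "?f (m + k) = C * (vw A' k / qfac q k * (wp_quot A' b' k * wp_quot A' c' k * wp_quot A' d' k) *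
      (wp_quot A' (A'\<^sup>2 * q ^ (K + 1) / (b' * c' * d')) k * wp_quot A' (1 / q ^ K) k) * q ^ k)"
      unfolding wp_quot_def param
      unfolding e1 e2 C_def diff_add_inverse
      unfolding qfac_add b'_def c'_def d'_def
      by (simp only: times_divide_eq_left times_divide_eq_right divide_divide_eq_left
          times_divide_times_eq mult_ac)
  qed simp
  also have "jackson_sum A' b' c' d' K = qfac (A * q * q ^ (2 * m)) K * qfac (A * q / (b * c)) K
      * qfac (a * q / b * q ^ m) K * qfac (a * q / c * q ^ m) K
      / (qfac (A * q / b * q ^ m) K * qfac (A * q / c * q ^ m) K * qfac (a * q * q ^ (2 * m)) K * qfac (a * q / (b * c)) K)"
  proof -
    have "jackson_sum A' b' c' d' K * (qfac (A * q / b * q ^ m) K * qfac (A * q / c * q ^ m) K * qfac (a * q * q ^ (2 * m)) K * qfac (a * q / (b * c)) K)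
      = qfac (A * q * q ^ (2 * m)) K * qfac (A * q / (b * c)) K * qfac (a * q / b * q ^ m) K * qfac (a * q / c * q ^ m) K"
      using jackson[OF nz', of K, unfolded param, unfolded A'q] den spl aq by simp
    then show ?thesis
      using den spl spl'[of "a * q / (b * c)"] aq by (simp add: divide_simps)
  qed
  also have "C * \<dots> = (qfac (A * q) (2 * m) * qfac (A * q * q ^ (2 * m)) K) * (qfac b m * qfac c m * qfac d m * qfac (1 / q ^ M) m)
      * (qfac (a * q / b * q ^ m) K * qfac (a * q / c * q ^ m) K * qfac (A * q / (b * c)) K)
     / ((qfac (a * q) (2 * m) * qfac (a * q * q ^ (2 * m)) K) * qfac (A * q / b) M * qfac (A * q / c) M
        * qfac (b * c / (a * q ^ M)) m * qfac (A * q ^ (M + 1)) m * qfac (a * q / (b * c)) K)"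
    by (simp add: C_def spl mult_ac)
  also have "\<dots> = qfac (A * q) M * (qfac b m * qfac c m * qfac d m * qfac (1 / q ^ M) m)
      * (qfac (a * q / b * q ^ m) K * qfac (a * q / c * q ^ m) K * qfac (A * q / (b * c)) K)
     / (qfac (a * q) M * qfac (a * q ^ (M + 1)) m * qfac (A * q / b) M * qfac (A * q / c) M
        * qfac (b * c / (a * q ^ M)) m * qfac (a * q / (b * c)) K)"
    unfolding dbl using den(4) spl(4) by (simp add: mult_ac)
  also have "\<dots> = qfac (A * q) M * qfac (a * q / b) M * qfac (a * q / c) M * qfac (A * q / (b * c)) M
      / (qfac (a * q) M * qfac (A * q / b) M * qfac (A * q / c) M * qfac (a * q / (b * c)) M)
      * ((qfac b m * qfac c m * qfac d m * qfac (1 / q ^ M) m)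
      / (qfac (a * q / b) m * qfac (a * q / c) m * qfac (b * c / (A * q ^ M)) m * qfac (a * q ^ (M + 1)) m))
      * (a / A) ^ m"
  proof -
    \<comment> \<open>The last \<open>m\<close> factors of \<open>(xq/(bc);q)_M\<close> are reversed
      for \<open>x = A\<close> and \<open>x = a\<close>. The two monomials differ by the ratio
      \<open>(A / a) ^ m\<close>, which is where the power of \<open>a / A\<close> comes
      from.\<close>
    define r where "r x = rev_factor (x * q / (b * c) * q ^ K) m" for x
    have rev: "qfac (x * q / (b * c) * q ^ K) m = r x * qfac (b * c / (x * q ^ M)) m" if "x \<noteq> 0" for x
      unfolding r_def using that nz by (intro qfac_reverse) (simp add: M power_add)
    have r: "r A * (a / A) ^ m = r a"
      using nz rev_factor_ratio[of "A * q / (b * c) * q ^ K" "a * q / (b * c) * q ^ K" m]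
      by (simp add: r_def)
    have "r a \<noteq> 0" "r A \<noteq> 0"
      using nz by (auto simp: r_def rev_factor_nonzero)
    have 1: "qfac (A * q / (b * c)) M * (a / A) ^ m = qfac (A * q / (b * c)) K * r a * qfac (b * c / (A * q ^ M)) m"
      unfolding spl' rev[OF nz(1)] r[symmetric] by (simp only: mult_ac)
    have 2: "qfac (a * q / (b * c)) M = qfac (a * q / (b * c)) K * r a * qfac (b * c / (a * q ^ M)) m"
      unfolding spl' rev[OF nz(2)] by (simp only: mult_ac)
    have "qfac (A * q) M * qfac (a * q / b) M * qfac (a * q / c) M * qfac (A * q / (b * c)) M
        / (qfac (a * q) M * qfac (A * q / b) M * qfac (A * q / c) M * qfac (a * q / (b * c)) M)
        * ((qfac b m * qfac c m * qfac d m * qfac (1 / q ^ M) m)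
        / (qfac (a * q / b) m * qfac (a * q / c) m * qfac (b * c / (A * q ^ M)) m * qfac (a * q ^ (M + 1)) m))
        * (a / A) ^ m
      = qfac (A * q) M * qfac (a * q / b) M * qfac (a * q / c) M * (qfac (A * q / (b * c)) M * (a / A) ^ m)
        / (qfac (a * q) M * qfac (A * q / b) M * qfac (A * q / c) M * qfac (a * q / (b * c)) M)
        * ((qfac b m * qfac c m * qfac d m * qfac (1 / q ^ M) m)
        / (qfac (a * q / b) m * qfac (a * q / c) m * qfac (b * c / (A * q ^ M)) m * qfac (a * q ^ (M + 1)) m))"
      by (simp only: times_divide_eq_left times_divide_eq_right mult_ac)
    also have "\<dots> = qfac (A * q) M * (qfac b m * qfac c m * qfac d m * qfac (1 / q ^ M) m)
      * (qfac (a * q / b * q ^ m) K * qfac (a * q / c * q ^ m) K * qfac (A * q / (b * c)) K)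
     / (qfac (a * q) M * qfac (a * q ^ (M + 1)) m * qfac (A * q / b) M * qfac (A * q / c) M
        * qfac (b * c / (a * q ^ M)) m * qfac (a * q / (b * c)) K)"
      unfolding 1 2 spl(5,6) using den(7-9) \<open>r a \<noteq> 0\<close> by (simp add: mult_ac)
    finally show ?thesis ..
  qed
  finally show ?thesis .
qed

text \<open>The kernel of a WP-Bailey pair,
  \<open>(A;q)_(n+m) (A/a;q)_(n-m) / ((q;q)_(n-m) (aq;q)_(n+m))\<close>, with the factor
  \<open>(A;q)_n\<close> removed from the numerator.\<close>

definition kernel :: "complex \<Rightarrow> complex \<Rightarrow> nat \<Rightarrow> nat \<Rightarrow> complex" where
  "kernel a A n m = qfac (A * q ^ n) m * qfac (A / a) (n - m) / (qfac q (n - m) * qfac (a * q) (n + m))"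

text \<open>The base \<open>AB/(a^2 q)\<close> is chosen so that, together with the powers of
  \<open>aq/A\<close> and \<open>aq/B\<close> left by the two expansions, it yields the argument
  \<open>q\<close> of the single series.\<close>

definition kernel_weight :: "complex \<Rightarrow> complex \<Rightarrow> complex \<Rightarrow> nat \<Rightarrow> complex" where
  "kernel_weight a A B m = vw a m / qfac q m * (qfac (a\<^sup>2 * q / (A * B)) m / qfac (A * B / a) m)
     * (A * B / (a\<^sup>2 * q)) ^ m"

definition kernel_sum :: "complex \<Rightarrow> complex \<Rightarrow> complex \<Rightarrow> nat \<Rightarrow> nat \<Rightarrow> complex" where
  "kernel_sum a A B n l = (\<Sum>m\<le>min n l. kernel_weight a A B m * (kernel a A n m * kernel a B l m))"

section \<open>Summing products of kernels over \<open>m\<close>\<close>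

lemma kernel_sum_commute: "kernel_sum a A B n l = kernel_sum a B A l n"
  by (simp add: kernel_sum_def kernel_weight_def min.commute mult_ac)

lemma rev_factor_split: "k \<le> n \<Longrightarrow> rev_factor x n = rev_factor x k * rev_factor (x * q ^ k) (n - k)"
proof (induction "n - k" arbitrary: n)
  case (Suc i)
  then obtain n' where n': "n = Suc n'" "k \<le> n'" "i = n' - k"
    by (cases n) auto
  have "q ^ k * q ^ (n' - k) = q ^ n'"
    using n' by (simp flip: power_add)
  then show ?case
    using Suc(1)[of n'] n' by (simp add: rev_factor_def Suc_diff_le mult.assoc)
qed (simp add: rev_factor_def)

lemma qfac_inverse_power:
  assumes "k \<le> n"
  shows "qfac (1 / q ^ n) k = rev_factor (1 / q ^ n) k * qfac q n / qfac q (n - k)"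
proof -
  have "q ^ n = q ^ (n - k) * q ^ k"
    using assms by (simp flip: power_add)
  then have "qfac (1 / q ^ n) k = rev_factor (1 / q ^ n) k * qfac (q * q ^ (n - k)) k"
    by (intro qfac_reverse) simp
  then show ?thesis
    using qfac_split[of "n - k" n q] assms by simp
qed

text \<open>Jackson's parameters are \<open>a^2 q/(AB)\<close>, \<open>q^-n\<close>,
  \<open>Aq^n\<close> with length \<open>l\<close>, so balancing supplies \<open>Bq^l\<close>. In
  the cleared sum the troublesome factor reverses to \<open>(Aq^(n-l)/a;q)_(l-k)\<close>; multiplied
  by \<open>(A/a;q)_(n-l)\<close> it becomes the \<open>(A/a;q)_(n-k)\<close> of the kernel, without
  any division by it.\<close>

lemma kernel_sum_cleared:
  assumes nz: "a \<noteq> 0" "A \<noteq> 0" "B \<noteq> 0" and l: "l \<le> n"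
    and den: "qfac (A * B / a) l \<noteq> 0" "qfac (a * q) (n + l) \<noteq> 0"
  shows "qfac (A / a) (n - l) * cleared_sum a (a\<^sup>2 * q / (A * B)) (1 / q ^ n) (A * q ^ n) l
    = qfac (A * B / a) l * qfac (a * q) (n + l) * qfac q n * qfac (a * q) (2 * l) * qfac q l
      * rev_factor (a * q / (A * q ^ n)) l * rev_factor (a * q / (B * q ^ l)) l * kernel_sum a A B n l"
proof -
  define b c d where "b = a\<^sup>2 * q / (A * B)" and "c = 1 / q ^ n" and "d = A * q ^ n"
  have param: "a * q / b = A * B / a" "a * q / c = a * q * q ^ n" "a * q / d = a * q / (A * q ^ n)"
    "a\<^sup>2 * q ^ (l + 1) / (b * c * d) = B * q ^ l" "b * c * d / (a * q ^ l) = a * q / (B * q ^ l)"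
    "a * q ^ (l + 1) = a * q * q ^ l"
    using nz by (simp_all add: b_def c_def d_def power2_eq_square)
  define C where "C = qfac (A * B / a) l * qfac (a * q) (n + l) * qfac q n * qfac (a * q) (2 * l) * qfac q l
      * rev_factor (a * q / (A * q ^ n)) l * rev_factor (a * q / (B * q ^ l)) l"
  have "qfac (A / a) (n - l) * cleared_sum a b c d l = C * kernel_sum a A B n l"
    unfolding cleared_sum_def kernel_sum_def sum_distrib_left param min_absorb2[OF l]
  proof (rule sum.cong)
    fix k assume "k \<in> {..l}"
    then have k: "k \<le> l" "k \<le> n"
      using l by auto
    define x y where "x = a * q / (A * q ^ n)" and "y = a * q / (B * q ^ l)"
    have xy: "x \<noteq> 0" "y \<noteq> 0"
      using nz by (auto simp: x_def y_def)
    have den': "qfac (A * B / a) k \<noteq> 0" "qfac (a * q) (n + k) \<noteq> 0" "qfac (a * q) (l + k) \<noteq> 0"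
      using qfac_nonzero_mono[OF den(1), of k] qfac_nonzero_mono[OF den(2), of "n + k"]
        qfac_nonzero_mono[OF den(2), of "l + k"] k l by auto
    have 1: "qfac (A * B / a * q ^ k) (l - k) = qfac (A * B / a) l / qfac (A * B / a) k"
      using qfac_split[OF k(1), of "A * B / a"] den' by simp
    have 2: "qfac (a * q * q ^ n * q ^ k) (l - k) = qfac (a * q) (n + l) / qfac (a * q) (n + k)"
      using qfac_split[of "n + k" "n + l" "a * q"] den' k by (simp add: power_add mult.assoc)
    have 3: "qfac (a * q * q ^ l * q ^ k) (l - k) = qfac (a * q) (2 * l) / qfac (a * q) (l + k)"
      using qfac_split[of "l + k" "2 * l" "a * q"] den' k by (simp add: power_add mult.assoc)
    have 4: "qfac (x * q ^ k) (l - k) = rev_factor x l / rev_factor x k * qfac (A / a * q ^ (n - l)) (l - k)"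
    proof -
      have "q ^ n = q ^ (n - l) * q ^ (l - k) * q ^ k"
        using k l by (simp flip: power_add)
      then have "qfac (x * q ^ k) (l - k) = rev_factor (x * q ^ k) (l - k) * qfac (A / a * q ^ (n - l)) (l - k)"
        using nz by (intro qfac_reverse) (simp add: x_def)
      then show ?thesis
        using rev_factor_split[OF k(1), of x] rev_factor_nonzero[OF xy(1)] by simp
    qed
    have 5: "qfac (y * q ^ k) (l - k) = rev_factor y l / rev_factor y k * qfac (B / a) (l - k)"
    proof -
      have "q ^ l = q ^ (l - k) * q ^ k"
        using k by (simp flip: power_add)
      then have "qfac (y * q ^ k) (l - k) = rev_factor (y * q ^ k) (l - k) * qfac (B / a) (l - k)"
        using nz by (intro qfac_reverse) (simp add: y_def)
      then show ?thesis
        using rev_factor_split[OF k(1), of y] rev_factor_nonzero[OF xy(2)] by simp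
    qed
    have 6: "qfac (A / a) (n - k) = qfac (A / a) (n - l) * qfac (A / a * q ^ (n - l)) (l - k)"
      using qfac_split[of "n - l" "n - k" "A / a"] k l by simp
    have rx: "rev_factor (1 / q ^ n) k = (A / (a * q)) ^ k * rev_factor x k"
      and ry: "rev_factor (1 / q ^ l) k = (B / (a * q)) ^ k * rev_factor y k"
      using rev_factor_ratio[OF xy(1), of "1 / q ^ n"] rev_factor_ratio[OF xy(2), of "1 / q ^ l"]
      by (simp_all add: x_def y_def)
    have pow: "(A / (a * q)) ^ k * (B / (a * q)) ^ k * q ^ k = (A * B / (a\<^sup>2 * q)) ^ k"
      by (simp add: power_mult_distrib[symmetric] power2_eq_square mult.assoc)
    show "qfac (A / a) (n - l) * (vw a k / qfac q k
       * (qfac b k * qfac (A * B / a * q ^ k) (l - k)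
         * (qfac c k * qfac (a * q * q ^ n * q ^ k) (l - k))
         * (qfac d k * qfac (a * q / (A * q ^ n) * q ^ k) (l - k)))
       * (qfac (B * q ^ l) k * qfac (a * q / (B * q ^ l) * q ^ k) (l - k)
         * (qfac (1 / q ^ l) k * qfac (a * q * q ^ l * q ^ k) (l - k))) * q ^ k)
       = C * (kernel_weight a A B k * (kernel a A n k * kernel a B l k))"
      unfolding x_def[symmetric] y_def[symmetric] 1 2 3 4 5 kernel_def kernel_weight_def
        pow[symmetric] C_def 6 c_def d_def b_def qfac_inverse_power[OF k(1)] qfac_inverse_power[OF k(2)] rx ry
      using xy by (simp add: rev_factor_nonzero mult_ac)
  qed simp
  then show ?thesis
    by (simp add: b_def c_def d_def C_def)
qed

lemma kernel_sum_eq: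
  assumes nz: "a \<noteq> 0" "A \<noteq> 0" "B \<noteq> 0" and l: "l \<le> n"
    and den: "qfac (A * B / a) n \<noteq> 0" "qfac (a * q) (n + l) \<noteq> 0"
  shows "kernel_sum a A B n l = qfac (A / a) (n - l) * qfac (A * B / a) (n + l)
      * qfac (a * q / B * q ^ (n - l)) l * qfac (a * q / A) l * (A * B / (a\<^sup>2 * q)) ^ l
      / (qfac (A * B / a) n * qfac (A * B / a) l * qfac (a * q) (n + l) * qfac q n * qfac q l)"
proof -
  define b c d where "b = a\<^sup>2 * q / (A * B)" and "c = 1 / q ^ n" and "d = A * q ^ n"
  have nz': "b \<noteq> 0" "c \<noteq> 0" "d \<noteq> 0"
    using nz by (auto simp: b_def c_def d_def)
  have param: "a * q / (b * c) = A * B / a * q ^ n" "a * q / (b * d) = B / (a * q ^ n)"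
    "a * q / (c * d) = a * q / A" "b * c * d / (a * q ^ l) = a * q / (B * q ^ l)"
    using nz by (simp_all add: b_def c_def d_def power2_eq_square)
  define r s where "r = rev_factor (a * q / (A * q ^ n)) l" and "s = rev_factor (a * q / (B * q ^ l)) l"
  have rs: "r \<noteq> 0" "s \<noteq> 0"
    using nz by (auto simp: r_def s_def rev_factor_nonzero)
  have den': "qfac (A * B / a) l \<noteq> 0" "qfac (a * q) (2 * l) \<noteq> 0"
    using qfac_nonzero_mono[OF den(1), of l] qfac_nonzero_mono[OF den(2), of "2 * l"] l by auto
  have "q ^ n = q ^ (n - l) * q ^ l"
    using l by (simp flip: power_add)
  \<comment> \<open>Reversed, this factor completes \<open>(aq/B;q)_(n-l)\<close> to the
    \<open>(aq/B;q)_n\<close> that occurs in the double sum.\<close>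
  then have "qfac (B / (a * q ^ n)) l = rev_factor (B / (a * q ^ n)) l * qfac (a * q / B * q ^ (n - l)) l"
    using nz by (intro qfac_reverse) simp
  also have "rev_factor (B / (a * q ^ n)) l = (A * B / (a\<^sup>2 * q)) ^ l * r"
    using rev_factor_ratio[of "a * q / (A * q ^ n)" "B / (a * q ^ n)" l] nz
    by (simp add: r_def power2_eq_square mult_ac)
  finally have rev: "qfac (B / (a * q ^ n)) l
      = (A * B / (a\<^sup>2 * q)) ^ l * r * qfac (a * q / B * q ^ (n - l)) l" .
  have "qfac (A * B / a) l * qfac (a * q) (n + l) * qfac q n * qfac (a * q) (2 * l) * qfac q l
      * r * s * kernel_sum a A B n l = qfac (A / a) (n - l) * cleared_sum a b c d l"
    unfolding b_def c_def d_def r_def s_def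
    by (rule kernel_sum_cleared[OF nz l den'(1) den(2), symmetric])
  also have "\<dots> = qfac (A / a) (n - l) * (qfac (a * q) (2 * l) * qfac (A * B / a * q ^ n) l
      * ((A * B / (a\<^sup>2 * q)) ^ l * r * qfac (a * q / B * q ^ (n - l)) l) * qfac (a * q / A) l * s)"
    unfolding jackson_cleared[OF nz(1) nz'] param rev s_def by simp
  finally have "qfac (A * B / a) l * qfac (a * q) (n + l) * qfac q n * qfac q l * kernel_sum a A B n l
      = qfac (A / a) (n - l) * (qfac (A * B / a * q ^ n) l
      * ((A * B / (a\<^sup>2 * q)) ^ l * qfac (a * q / B * q ^ (n - l)) l) * qfac (a * q / A) l)"
    using rs den' by (simp add: mult_ac)
  then show ?thesis
    using den den' by (subst nonzero_eq_divide_eq) (simp_all add: qfac_add[of "A * B / a"] mult_ac)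
qed

section \<open>Translation of \<open>qpoch\<close>, negative indices and square roots\<close>

lemma qpoch_of_nat: "qpoch x q (int n) = qfac x n"
  by (simp add: qpoch_def qfac_def)

lemma qpoch_diff: "l \<le> n \<Longrightarrow> qpoch x q (int n - int l) = qfac x (n - l)"
  using qpoch_of_nat[of x "n - l"] by (simp add: of_nat_diff)

lemma qpoch_diff_neg:
  assumes "n < l"
  shows "qpoch x q (int n - int l) = 1 / qfac (x / q ^ (l - n)) (l - n)"
proof -
  have e: "int n - int l = - int (l - n)"
    using assms by simp
  show ?thesis
    unfolding e using assms
    by (simp add: qpoch_def qfac_def power_int_minus divide_inverse del: of_nat_diff)
qed

lemma qpochs_of_nat: "qpochs xs q (int n) = (\<Prod>x\<leftarrow>xs. qfac x n)"
  by (simp add: qpochs_def qpoch_of_nat)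

lemma vw_sqrt:
  assumes "qfac (csqrt a) n \<noteq> 0" "qfac (- csqrt a) n \<noteq> 0"
  shows "qfac a n * qfac (q * csqrt a) n * qfac (- q * csqrt a) n / (qfac (csqrt a) n * qfac (- csqrt a) n) = vw a n"
proof (cases "n = 0")
  case False
  define s where "s = csqrt a"
  have a: "a = s * s"
    by (simp add: s_def flip: power2_eq_square)
  have power2_n: "q ^ (2 * n) = q ^ n * q ^ n"
    by (simp add: mult_2 power_add)
  have "qfac s n * (1 - s * q ^ n) = (1 - s) * qfac (q * s) n"
    using qfac_Suc[of s n] qfac_Suc'[of s n] by (simp add: mult.commute)
  moreover have "qfac (- s) n * (1 + s * q ^ n) = (1 + s) * qfac (- q * s) n"
    using qfac_Suc[of "- s" n] qfac_Suc'[of "- s" n] by (simp add: mult.commute)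
  ultimately have "(qfac s n * (1 - s * q ^ n)) * (qfac (- s) n * (1 + s * q ^ n))
      = ((1 - s) * qfac (q * s) n) * ((1 + s) * qfac (- q * s) n)"
    by simp
  moreover have "(1 - s * q ^ n) * (1 + s * q ^ n) = 1 - a * q ^ (2 * n)"
    by (simp add: a power2_n) (simp add: algebra_simps)
  moreover have "(1 - s) * (1 + s) = 1 - a"
    by (simp add: a algebra_simps)
  ultimately have 1: "(1 - a) * (qfac (q * s) n * qfac (- q * s) n) = qfac s n * qfac (- s) n * (1 - a * q ^ (2 * n))"
    by (metis (no_types, lifting) mult.assoc mult.left_commute)
  \<comment> \<open>For \<open>n > 0\<close> the first factors of the denominators are
    \<open>1 - s\<close> and \<open>1 + s\<close>, so the hypotheses rule out
    \<open>a = 1\<close>.\<close>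
  have "qfac s 1 \<noteq> 0" "qfac (- s) 1 \<noteq> 0"
    using assms False qfac_nonzero_mono[of _ n 1] by (auto simp: s_def)
  then have 2: "1 - a \<noteq> 0"
    by (auto simp: qfac_def a algebra_simps square_eq_1_iff eq_neg_iff_add_eq_0)
  have "(1 - a) * (qfac a n * qfac (q * s) n * qfac (- q * s) n)
      = (1 - a) * (vw a n * (qfac s n * qfac (- s) n))"
  proof -
    have "(1 - a) * (qfac a n * qfac (q * s) n * qfac (- q * s) n)
        = qfac a n * ((1 - a) * (qfac (q * s) n * qfac (- q * s) n))"
      by (simp only: mult_ac)
    also have "\<dots> = (qfac a n * (1 - a * q ^ (2 * n))) * (qfac s n * qfac (- s) n)"
      unfolding 1 by (simp only: mult_ac)
    finally show ?thesis
      unfolding vw_mult[symmetric] by (simp only: mult_ac)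
  qed
  then show ?thesis
    using 2 assms by (simp add: s_def divide_simps)
qed simp

text \<open>For \<open>n < l\<close> both negative-index factorials are reciprocals. Reversing them
  turns their quotient into \<open>(B/a;q)_(l-n) / (aq/A;q)_(l-n)\<close> times a power of
  \<open>a^2 q/(AB)\<close>, which absorbs the asymmetric power of \<open>AB/a^2\<close>. The result
  is the mirror image of the case \<open>l \<le> n\<close>.\<close>

lemma kernel_sum_qpoch:
  assumes nz: "a \<noteq> 0" "A \<noteq> 0" "B \<noteq> 0"
    and den: "qfac (A * B / a) n \<noteq> 0" "qfac (A * B / a) l \<noteq> 0" "qfac (a * q) (n + l) \<noteq> 0"
      "l \<le> n \<Longrightarrow> qfac (a * q / B) (n - l) \<noteq> 0" "n < l \<Longrightarrow> qfac (A / a / q ^ (l - n)) (l - n) \<noteq> 0"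
  shows "qpoch (A / a) q (int n - int l) / qpoch (a * q / B) q (int n - int l)
      * (qfac (A * B / a) (n + l) / qfac (a * q) (n + l)) * (qfac (a * q / B) n / qfac (A * B / a) n)
      * (qfac (a * q / A) l / qfac (A * B / a) l) * (q ^ n * (A * B / a\<^sup>2) ^ l / (qfac q n * qfac q l))
    = q ^ n * q ^ l * kernel_sum a A B n l"
proof (cases "l \<le> n")
  case True
  have pow: "(A * B / a\<^sup>2) ^ l = q ^ l * (A * B / (a\<^sup>2 * q)) ^ l"
    by (simp flip: power_mult_distrib)
  have split: "qfac (a * q / B) n = qfac (a * q / B) (n - l) * qfac (a * q / B * q ^ (n - l)) l"
    using qfac_add[of "a * q / B" "n - l" l] True by simp
  show ?thesis
    unfolding kernel_sum_eq[OF nz True den(1,3)] qpoch_diff[OF True] pow split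
    using den(4)[OF True] by (simp add: mult_ac)
next
  case False
  define k where "k = l - n"
  have l: "l = n + k" "n < l"
    using False by (auto simp: k_def)
  define r where "r = rev_factor (A / a / q ^ k) k"
  have r: "r \<noteq> 0"
    using nz by (simp add: r_def rev_factor_nonzero)
  have P1: "qfac (A / a / q ^ k) k = r * qfac (a * q / A) k"
    unfolding r_def using nz by (intro qfac_reverse) simp
  have "qfac (a * q / B / q ^ k) k = rev_factor (a * q / B / q ^ k) k * qfac (B / a) k"
    using nz by (intro qfac_reverse) simp
  also have "rev_factor (a * q / B / q ^ k) k = (a\<^sup>2 * q / (A * B)) ^ k * r"
    using nz rev_factor_ratio[of "A / a / q ^ k" "a * q / B / q ^ k" k]
    by (simp add: r_def power2_eq_square mult_ac)
  finally have P2: "qfac (a * q / B / q ^ k) k = (a\<^sup>2 * q / (A * B)) ^ k * r * qfac (B / a) k" .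
  have 1: "qfac (a * q / B / q ^ k) k / qfac (A / a / q ^ k) k
      = (a\<^sup>2 * q / (A * B)) ^ k * qfac (B / a) k / qfac (a * q / A) k"
    unfolding P1 P2 using r by simp
  \<comment> \<open>This is the definedness of \<open>(A/a;q)_(n-l)\<close>, read through the
    reversal.\<close>
  have nz_k: "qfac (a * q / A) k \<noteq> 0"
    using den(5)[OF l(2)] P1 by (simp add: k_def[symmetric])
  have 2: "qfac (a * q / A) l = qfac (a * q / A) k * qfac (a * q / A * q ^ k) n"
    using qfac_add[of "a * q / A" k n] by (simp add: l add.commute)
  have 3: "(a\<^sup>2 * q / (A * B)) ^ k * (A * B / a\<^sup>2) ^ l = q ^ l * (A * B / (a\<^sup>2 * q)) ^ n"
  proof -
    have "(a\<^sup>2 * q / (A * B)) ^ k * (A * B / a\<^sup>2) ^ k = q ^ k"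
      "(A * B / a\<^sup>2) ^ n = q ^ n * (A * B / (a\<^sup>2 * q)) ^ n"
      using nz by (simp_all flip: power_mult_distrib)
    then show ?thesis
      by (simp add: l power_add mult_ac)
  qed
  have "qpoch (A / a) q (int n - int l) / qpoch (a * q / B) q (int n - int l)
      = (a\<^sup>2 * q / (A * B)) ^ k * qfac (B / a) k / qfac (a * q / A) k"
    using 1 by (simp add: qpoch_diff_neg[OF l(2)] k_def[symmetric])
  note quot = this
  have "qpoch (A / a) q (int n - int l) / qpoch (a * q / B) q (int n - int l)
      * (qfac (A * B / a) (n + l) / qfac (a * q) (n + l)) * (qfac (a * q / B) n / qfac (A * B / a) n)
      * (qfac (a * q / A) l / qfac (A * B / a) l) * (q ^ n * (A * B / a\<^sup>2) ^ l / (qfac q n * qfac q l))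
    = q ^ n * ((a\<^sup>2 * q / (A * B)) ^ k * (A * B / a\<^sup>2) ^ l) * qfac (B / a) k
      * (qfac (A * B / a) (n + l) / qfac (a * q) (n + l)) * (qfac (a * q / B) n / qfac (A * B / a) n)
      * (qfac (a * q / A * q ^ k) n / qfac (A * B / a) l) * (1 / (qfac q n * qfac q l))"
    unfolding quot 2 using nz_k by (simp add: mult_ac)
  also have "\<dots> = q ^ n * q ^ l * kernel_sum a B A l n"
  proof -
    have "kernel_sum a B A l n = qfac (B / a) k * qfac (A * B / a) (n + l)
        * qfac (a * q / A * q ^ k) n * qfac (a * q / B) n * (A * B / (a\<^sup>2 * q)) ^ n
        / (qfac (A * B / a) l * qfac (A * B / a) n * qfac (a * q) (n + l) * qfac q l * qfac q n)"
      unfolding k_def add.commute[of n l] mult.commute[of A B]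
      by (rule kernel_sum_eq) (use nz l(2) den in \<open>auto simp: add.commute mult.commute\<close>)
    then show ?thesis
      unfolding 3 by (simp add: mult_ac)
  qed
  finally show ?thesis
    by (simp add: kernel_sum_commute[of a A B])
qed

section \<open>The transformation\<close>

text \<open>The argument \<open>e\<close> stands for \<open>aq/d\<close>.\<close>

definition wp_ratio :: "complex \<Rightarrow> complex \<Rightarrow> complex \<Rightarrow> complex \<Rightarrow> complex \<Rightarrow> nat \<Rightarrow> nat \<Rightarrow> complex" where
  "wp_ratio a b c d e N n = qfac b n * qfac c n * qfac d n * qfac (1 / q ^ N) n
     / (qfac (a * q / b) n * qfac (a * q / c) n * qfac e n * qfac (a * q ^ (N + 1)) n)"

definition prefactor :: "complex \<Rightarrow> complex \<Rightarrow> complex \<Rightarrow> complex \<Rightarrow> nat \<Rightarrow> complex" where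
  "prefactor a A b c M = qfac (A * q) M * qfac (a * q / b) M * qfac (a * q / c) M * qfac (A * q / (b * c)) M
      / (qfac (a * q) M * qfac (A * q / b) M * qfac (A * q / c) M * qfac (a * q / (b * c)) M)"

text \<open>A Bailey-type step: summing the kernel against the very-well-poised weight in base
  \<open>A\<close> returns the well-poised ratio in base \<open>a\<close>.\<close>

lemma kernel_transform:
  assumes nz: "A \<noteq> 0" "a \<noteq> 0" "b \<noteq> 0" "c \<noteq> 0" and m: "m \<le> M"
    and d: "d = A * a * q ^ (M + 1) / (b * c)"
    and den: "qfac (A * q / b) M \<noteq> 0" "qfac (A * q / c) M \<noteq> 0" "qfac (b * c / (a * q ^ M)) M \<noteq> 0"
      "qfac (A * q ^ (M + 1)) M \<noteq> 0" "qfac (a * q) (M + m) \<noteq> 0" "qfac (a * q / (b * c)) M \<noteq> 0"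
      "qfac (a * q / b) m \<noteq> 0" "qfac (a * q / c) m \<noteq> 0" "qfac (b * c / (A * q ^ M)) m \<noteq> 0"
  shows "(\<Sum>n=m..M. vw A n * wp_ratio A b c d (b * c / (a * q ^ M)) M n * q ^ n * kernel a A n m)
    = prefactor a A b c M * wp_ratio a b c d (b * c / (A * q ^ M)) M m * (a * q / A) ^ m"
proof -
  have "(\<Sum>n=m..M. vw A n * wp_ratio A b c d (b * c / (a * q ^ M)) M n * q ^ n * kernel a A n m)
     = q ^ m * (\<Sum>n=m..M. vw A n * qfac (A * q ^ n) m * qfac (A / a) (n - m) / (qfac q (n - m) * qfac (a * q) (n + m))
      * (qfac b n * qfac c n * qfac d n * qfac (1 / q ^ M) n)
      / (qfac (A * q / b) n * qfac (A * q / c) n * qfac (b * c / (a * q ^ M)) n * qfac (A * q ^ (M + 1)) n)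
      * q ^ (n - m))"
    unfolding sum_distrib_left
  proof (rule sum.cong)
    fix n assume "n \<in> {m..M}"
    then have "q ^ n = q ^ m * q ^ (n - m)"
      by (simp flip: power_add)
    then show "vw A n * wp_ratio A b c d (b * c / (a * q ^ M)) M n * q ^ n * kernel a A n m
      = q ^ m * (vw A n * qfac (A * q ^ n) m * qfac (A / a) (n - m) / (qfac q (n - m) * qfac (a * q) (n + m))
      * (qfac b n * qfac c n * qfac d n * qfac (1 / q ^ M) n)
      / (qfac (A * q / b) n * qfac (A * q / c) n * qfac (b * c / (a * q ^ M)) n * qfac (A * q ^ (M + 1)) n)
      * q ^ (n - m))"
      by (simp add: wp_ratio_def kernel_def mult_ac)
  qed simp
  also have "\<dots> = prefactor a A b c M * wp_ratio a b c d (b * c / (A * q ^ M)) M m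
      * (q ^ m * (a / A) ^ m)"
    unfolding well_poised_expansion[OF nz m d den] prefactor_def wp_ratio_def by (simp only: mult_ac)
  also have "q ^ m * (a / A) ^ m = (a * q / A) ^ m"
    by (simp add: mult_ac flip: power_mult_distrib)
  finally show ?thesis .
qed

lemma double_sum_transform:
  assumes nz: "a \<noteq> 0" "A \<noteq> 0" "B \<noteq> 0" "b \<noteq> 0" "c \<noteq> 0" "b' \<noteq> 0" "c' \<noteq> 0"
    and d: "d = A * a * q ^ (M + 1) / (b * c)" and d': "d' = B * a * q ^ (N + 1) / (b' * c')"
    and aq: "\<And>n l. n \<le> M \<Longrightarrow> l \<le> N \<Longrightarrow> qfac (a * q) (n + l) \<noteq> 0"
    and den_A: "qfac (A * q / b) M \<noteq> 0" "qfac (A * q / c) M \<noteq> 0" "qfac (b * c / (a * q ^ M)) M \<noteq> 0"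
      "qfac (A * q ^ (M + 1)) M \<noteq> 0" "qfac (a * q / (b * c)) M \<noteq> 0"
    and den_B: "qfac (B * q / b') N \<noteq> 0" "qfac (B * q / c') N \<noteq> 0" "qfac (b' * c' / (a * q ^ N)) N \<noteq> 0"
      "qfac (B * q ^ (N + 1)) N \<noteq> 0" "qfac (a * q / (b' * c')) N \<noteq> 0"
    and den_a: "qfac (a * q / b) (min M N) \<noteq> 0" "qfac (a * q / c) (min M N) \<noteq> 0"
      "qfac (b * c / (A * q ^ M)) (min M N) \<noteq> 0"
      "qfac (a * q / b') (min M N) \<noteq> 0" "qfac (a * q / c') (min M N) \<noteq> 0"
      "qfac (b' * c' / (B * q ^ N)) (min M N) \<noteq> 0"
  shows "(\<Sum>n\<le>M. \<Sum>l\<le>N. vw A n * wp_ratio A b c d (b * c / (a * q ^ M)) M n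
       * (vw B l * wp_ratio B b' c' d' (b' * c' / (a * q ^ N)) N l)
       * (q ^ n * q ^ l * kernel_sum a A B n l))
     = prefactor a A b c M * prefactor a B b' c' N * (\<Sum>m\<le>min M N.
         vw a m / qfac q m * (qfac (a\<^sup>2 * q / (A * B)) m / qfac (A * B / a) m)
         * wp_ratio a b c d (b * c / (A * q ^ M)) M m
         * wp_ratio a b' c' d' (b' * c' / (B * q ^ N)) N m * q ^ m)"
proof -
  define f where "f n = vw A n * wp_ratio A b c d (b * c / (a * q ^ M)) M n * q ^ n" for n
  define g where "g l = vw B l * wp_ratio B b' c' d' (b' * c' / (a * q ^ N)) N l * q ^ l" for l
  have "(\<Sum>n\<le>M. \<Sum>l\<le>N. vw A n * wp_ratio A b c d (b * c / (a * q ^ M)) M n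
       * (vw B l * wp_ratio B b' c' d' (b' * c' / (a * q ^ N)) N l)
       * (q ^ n * q ^ l * kernel_sum a A B n l))
     = (\<Sum>n\<le>M. \<Sum>l\<le>N. \<Sum>m\<le>min n l. kernel_weight a A B m *
         ((f n * kernel a A n m) * (g l * kernel a B l m)))"
    unfolding kernel_sum_def sum_distrib_left
    by (intro sum.cong[OF refl]) (simp only: f_def g_def mult_ac)
  also have "\<dots> = (\<Sum>m\<le>min M N. kernel_weight a A B m *
      ((\<Sum>n=m..M. f n * kernel a A n m) * (\<Sum>l=m..N. g l * kernel a B l m)))"
    by (rule sum_min_swap)
  also have "\<dots> = (\<Sum>m\<le>min M N. prefactor a A b c M * prefactor a B b' c' N *
         (vw a m / qfac q m * (qfac (a\<^sup>2 * q / (A * B)) m / qfac (A * B / a) m)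
         * wp_ratio a b c d (b * c / (A * q ^ M)) M m
         * wp_ratio a b' c' d' (b' * c' / (B * q ^ N)) N m * q ^ m))"
  proof (rule sum.cong)
    fix m assume "m \<in> {..min M N}"
    then have m: "m \<le> min M N" "m \<le> M" "m \<le> N"
      by auto
    have F: "(\<Sum>n=m..M. f n * kernel a A n m)
      = prefactor a A b c M * wp_ratio a b c d (b * c / (A * q ^ M)) M m * (a * q / A) ^ m"
      unfolding f_def
      by (rule kernel_transform[OF nz(2,1,4,5) m(2) d den_A(1-4) aq[OF le_refl m(3)] den_A(5)
            den_a(1-3)[THEN qfac_nonzero_mono, OF m(1)]])
    have G: "(\<Sum>l=m..N. g l * kernel a B l m)
      = prefactor a B b' c' N * wp_ratio a b' c' d' (b' * c' / (B * q ^ N)) N m * (a * q / B) ^ m"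
      unfolding g_def
      using kernel_transform[OF nz(3,1,6,7) m(3) d' den_B(1-4) _ den_B(5)
            den_a(4-6)[THEN qfac_nonzero_mono, OF m(1)]] aq[OF m(2) le_refl] by (simp add: add.commute)
    have pow: "(A * B / (a\<^sup>2 * q)) ^ m * (a * q / A) ^ m * (a * q / B) ^ m = q ^ m"
      using nz by (simp add: power2_eq_square flip: power_mult_distrib)
    show "kernel_weight a A B m *
        ((\<Sum>n=m..M. f n * kernel a A n m) * (\<Sum>l=m..N. g l * kernel a B l m))
      = prefactor a A b c M * prefactor a B b' c' N *
         (vw a m / qfac q m * (qfac (a\<^sup>2 * q / (A * B)) m / qfac (A * B / a) m)
         * wp_ratio a b c d (b * c / (A * q ^ M)) M m
         * wp_ratio a b' c' d' (b' * c' / (B * q ^ N)) N m * q ^ m)"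
      unfolding F G kernel_weight_def pow[symmetric] by (simp only: mult_ac)
  qed simp
  finally show ?thesis
    by (simp only: sum_distrib_left)
qed

section \<open>Matching the statement of the theorem\<close>

lemma power_int_neg: "q powi (- int M) = 1 / q ^ M"
  by (simp add: power_int_minus divide_inverse)

lemma qpochs_vw_ratio:
  assumes "qfac (csqrt A) n \<noteq> 0" "qfac (- csqrt A) n \<noteq> 0"
  shows "qpochs [A, q * csqrt A, - q * csqrt A, b, c, d, x, q powi (- int M)] q (int n)
      / qpochs [csqrt A, - csqrt A, q * A / b, q * A / c, e, y, A * q ^ (1 + M)] q (int n)
    = vw A n * wp_ratio A b c d e M n * (qfac x n / qfac y n)"
proof -
  have "q * A / b = A * q / b" "q * A / c = A * q / c" "1 + M = M + 1"
    by simp_all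
  then show ?thesis
    unfolding vw_sqrt[OF assms, symmetric] wp_ratio_def qpochs_of_nat power_int_neg
    by (simp only: list.map prod_list.Cons prod_list.Nil mult_1_left mult_1_right
        times_divide_eq_left times_divide_eq_right times_divide_times_eq divide_divide_eq_left mult_ac)
qed

lemma qpochs_prefactor:
  "qpochs [q * A, q * a / b, q * a / c, q * A / (b * c)] q (int M)
    / qpochs [q * a, q * A / b, q * A / c, q * a / (b * c)] q (int M) = prefactor a A b c M"
  by (simp add: qpochs_of_nat prefactor_def mult_ac)

lemma vwp_series_eq_sum:
  fixes M N :: nat
  assumes nz: "a \<noteq> 0" "A \<noteq> 0" "B \<noteq> 0"
    and den: "qfac (csqrt a) (min M N) \<noteq> 0" "qfac (- csqrt a) (min M N) \<noteq> 0"
  shows "vwp_series a [q * a\<^sup>2 / (A * B), b, c, b', c', d, d', q powi (- int M), q powi (- int N)] q q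
    = (\<Sum>m\<le>min M N. vw a m / qfac q m * (qfac (a\<^sup>2 * q / (A * B)) m / qfac (A * B / a) m)
         * wp_ratio a b c d (a * q / d) M m * wp_ratio a b' c' d' (a * q / d') N m * q ^ m)"
    (is "vwp_series a ?as q q = (\<Sum>m\<le>_. ?t m)")
proof -
  define u where "u m = qpochs ([a, q * csqrt a, - q * csqrt a] @ ?as) q (int m)
    / qpochs ([q, csqrt a, - csqrt a] @ map (\<lambda>x. q * a / x) ?as) q (int m) * q ^ m" for m
  have "vwp_series a ?as q q = (\<Sum>m. u m)"
    by (simp only: vwp_series_def u_def)
  also have "\<dots> = (\<Sum>m\<le>min M N. u m)"
  proof (rule suminf_finite)
    \<comment> \<open>Beyond \<open>min M N\<close> the numerator contains a zero factor, so the
      term is 0 whatever its denominator is.\<close>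
    fix m assume "m \<notin> {..min M N}"
    then have "qfac (1 / q ^ M) m = 0 \<or> qfac (1 / q ^ N) m = 0"
      using qfac_inverse_power_eq_0[of M m] qfac_inverse_power_eq_0[of N m] by auto
    then show "u m = 0"
      unfolding u_def qpochs_of_nat power_int_neg by auto
  qed simp
  also have "\<dots> = (\<Sum>m\<le>min M N. ?t m)"
  proof (rule sum.cong)
    fix m assume "m \<in> {..min M N}"
    then have s: "qfac (csqrt a) m \<noteq> 0" "qfac (- csqrt a) m \<noteq> 0"
      using den qfac_nonzero_mono[of _ "min M N" m] by auto
    have args: "q * a / (q * a\<^sup>2 / (A * B)) = A * B / a" "q * a\<^sup>2 / (A * B) = a\<^sup>2 * q / (A * B)"
      "q * a / (1 / q ^ M) = a * q ^ (M + 1)" "q * a / (1 / q ^ N) = a * q ^ (N + 1)"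
      "q * a / x = a * q / x" for x
      using nz by (simp_all add: power2_eq_square)
    show "u m = ?t m"
      unfolding vw_sqrt[OF s, symmetric] wp_ratio_def u_def qpochs_of_nat power_int_neg
        append.simps list.map args(1)
      unfolding args(3,4) unfolding args(2,5)
      by (simp only: prod_list.Cons prod_list.Nil mult_1_left mult_1_right
          times_divide_eq_left times_divide_eq_right times_divide_times_eq divide_divide_eq_left mult_ac)
  qed simp
  finally show ?thesis .
qed

end

theorem mainTheorem4:
  fixes M N :: nat and q a A B b c b' c' :: complex
  assumes nonzero: "q \<noteq> 0" "a \<noteq> 0" "A \<noteq> 0" "B \<noteq> 0" "b \<noteq> 0" "c \<noteq> 0" "b' \<noteq> 0" "c' \<noteq> 0"
    and q_lt_1: "cmod q < 1"
    \<comment> \<open>the shifted factorials of index \<open>n - l < 0\<close> are defined\<close>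
    and def_neg: "\<And>k. k \<le> N \<Longrightarrow> qpoch (A / a * q powi (- int k)) q (int k) \<noteq> 0"
                 "\<And>k. k \<le> N \<Longrightarrow> qpoch (q * a / B * q powi (- int k)) q (int k) \<noteq> 0"
    \<comment> \<open>the denominators in the double sum\<close>
    and den_diff: "\<And>n l. n \<le> M \<Longrightarrow> l \<le> N \<Longrightarrow> qpoch (q * a / B) q (int n - int l) \<noteq> 0"
    and den_sum: "\<And>n l. n \<le> M \<Longrightarrow> l \<le> N \<Longrightarrow> qpoch (q * a) q (int n + int l) \<noteq> 0"
    and den_n: "\<And>n. n \<le> M \<Longrightarrow>
      qpochs [csqrt A, - csqrt A, q * A / b, q * A / c, b * c * q powi (- int M) / a,
              A * B / a, A * q ^ (1 + M)] q (int n) \<noteq> 0"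
    and den_l: "\<And>l. l \<le> N \<Longrightarrow>
      qpochs [csqrt B, - csqrt B, q * B / b', q * B / c', b' * c' * q powi (- int N) / a,
              A * B / a, B * q ^ (1 + N)] q (int l) \<noteq> 0"
    \<comment> \<open>the denominators on the right-hand side\<close>
    and den_M: "qpochs [q * a, q * A / b, q * A / c, q * a / (b * c)] q (int M) \<noteq> 0"
    and den_N: "qpochs [q * a, q * B / b', q * B / c', q * a / (b' * c')] q (int N) \<noteq> 0"
    and den_W: "\<And>m. m \<le> min M N \<Longrightarrow>
      qpochs ([q, csqrt a, - csqrt a] @ map (\<lambda>x. q * a / x)
        [q * a\<^sup>2 / (A * B), b, c, b', c', A * a * q ^ (1 + M) / (b * c),
         B * a * q ^ (1 + N) / (b' * c'), q powi (- int M), q powi (- int N)]) q (int m) \<noteq> 0"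
  shows
    "(\<Sum>n=0..M. \<Sum>l=0..N.
        qpoch (A / a) q (int n - int l) / qpoch (q * a / B) q (int n - int l)
      * (qpoch (A * B / a) q (int n + int l) / qpoch (q * a) q (int n + int l))
      * (qpochs [A, q * csqrt A, - q * csqrt A, b, c, A * a * q ^ (1 + M) / (b * c),
                 q * a / B, q powi (- int M)] q (int n) /
         qpochs [csqrt A, - csqrt A, q * A / b, q * A / c, b * c * q powi (- int M) / a,
                 A * B / a, A * q ^ (1 + M)] q (int n))
      * (qpochs [B, q * csqrt B, - q * csqrt B, b', c', B * a * q ^ (1 + N) / (b' * c'),
                 q * a / A, q powi (- int N)] q (int l) /
         qpochs [csqrt B, - csqrt B, q * B / b', q * B / c', b' * c' * q powi (- int N) / a,
                 A * B / a, B * q ^ (1 + N)] q (int l))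
      * (q ^ n * (A * B / a\<^sup>2) ^ l / (qpoch q q (int n) * qpoch q q (int l))))
     = qpochs [q * A, q * a / b, q * a / c, q * A / (b * c)] q (int M) /
       qpochs [q * a, q * A / b, q * A / c, q * a / (b * c)] q (int M)
     * (qpochs [q * B, q * a / b', q * a / c', q * B / (b' * c')] q (int N) /
        qpochs [q * a, q * B / b', q * B / c', q * a / (b' * c')] q (int N))
     * vwp_series a
         [q * a\<^sup>2 / (A * B), b, c, b', c', A * a * q ^ (1 + M) / (b * c),
          B * a * q ^ (1 + N) / (b' * c'), q powi (- int M), q powi (- int N)] q q"
proof -
  interpret q_not_root_of_unity q
  proof
    fix k :: nat assume "k > 0"
    then have "cmod (q ^ k) < 1"
      using q_lt_1 by (simp add: norm_power power_less_one_iff)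
    then show "q ^ k \<noteq> 1" by auto
  qed (rule nonzero)
  define d d' where "d = A * a * q ^ (1 + M) / (b * c)" and "d' = B * a * q ^ (1 + N) / (b' * c')"
  define e e' where "e = b * c / (a * q ^ M)" and "e' = b' * c' / (a * q ^ N)"
  have d_alt: "d = A * a * q ^ (M + 1) / (b * c)" "d' = B * a * q ^ (N + 1) / (b' * c')"
    by (simp_all add: d_def d'_def)
  have e_alt: "b * c * q powi (- int M) / a = e" "b' * c' * q powi (- int N) / a = e'"
    by (simp_all add: e_def e'_def power_int_neg)
  \<comment> \<open>The partners of the two balancing parameters in the single series, in the form
    that the expansions produce.\<close>
  have aq_d: "a * q / d = b * c / (A * q ^ M)" "a * q / d' = b' * c' / (B * q ^ N)"
    using nonzero by (simp_all add: d_def d'_def)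
  have comm: "q * x / y = x * q / y" "q * x = x * q" for x y :: complex
    by simp_all
  note den_n' = den_n[unfolded e_alt qpochs_of_nat, simplified]
  note den_l' = den_l[unfolded e_alt qpochs_of_nat, simplified]
  have den_A: "qfac (A * q / b) M \<noteq> 0" "qfac (A * q / c) M \<noteq> 0" "qfac (b * c / (a * q ^ M)) M \<noteq> 0"
      "qfac (A * q ^ (M + 1)) M \<noteq> 0" "qfac (a * q / (b * c)) M \<noteq> 0"
    using den_n'[of M] den_M by (simp_all add: qpochs_of_nat e_def mult.commute)
  have den_B: "qfac (B * q / b') N \<noteq> 0" "qfac (B * q / c') N \<noteq> 0" "qfac (b' * c' / (a * q ^ N)) N \<noteq> 0"
      "qfac (B * q ^ (N + 1)) N \<noteq> 0" "qfac (a * q / (b' * c')) N \<noteq> 0"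
    using den_l'[of N] den_N by (simp_all add: qpochs_of_nat e'_def mult.commute)
  have aq: "qfac (a * q) (n + l) \<noteq> 0" if "n \<le> M" "l \<le> N" for n l
    using den_sum[OF that] qpoch_of_nat[of "q * a" "n + l"] by (simp add: mult.commute)
  have den_a: "qfac (a * q / b) (min M N) \<noteq> 0" "qfac (a * q / c) (min M N) \<noteq> 0"
      "qfac (a * q / d) (min M N) \<noteq> 0"
      "qfac (a * q / b') (min M N) \<noteq> 0" "qfac (a * q / c') (min M N) \<noteq> 0"
      "qfac (a * q / d') (min M N) \<noteq> 0"
      "qfac (csqrt a) (min M N) \<noteq> 0" "qfac (- csqrt a) (min M N) \<noteq> 0"
    using den_W[OF le_refl, folded d_def d'_def]
    by (simp_all add: qpochs_of_nat comm)
  \<comment> \<open>The factors in \<open>n - l\<close> and \<open>n + l\<close>, with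
    \<open>(aq/B;q)_n\<close>, \<open>(aq/A;q)_l\<close>, the two \<open>(AB/a;q)\<close>
    denominators and the final quotient, make up the kernel sum; the rest separates into a function
    of \<open>n\<close> and one of \<open>l\<close>.\<close>
  have summand: "qpoch (A / a) q (int n - int l) / qpoch (q * a / B) q (int n - int l)
      * (qpoch (A * B / a) q (int n + int l) / qpoch (q * a) q (int n + int l))
      * (qpochs [A, q * csqrt A, - q * csqrt A, b, c, d,
                 q * a / B, q powi (- int M)] q (int n) /
         qpochs [csqrt A, - csqrt A, q * A / b, q * A / c, b * c * q powi (- int M) / a,
                 A * B / a, A * q ^ (1 + M)] q (int n))
      * (qpochs [B, q * csqrt B, - q * csqrt B, b', c', d',
                 q * a / A, q powi (- int N)] q (int l) /
         qpochs [csqrt B, - csqrt B, q * B / b', q * B / c', b' * c' * q powi (- int N) / a,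
                 A * B / a, B * q ^ (1 + N)] q (int l))
      * (q ^ n * (A * B / a\<^sup>2) ^ l / (qpoch q q (int n) * qpoch q q (int l)))
      = vw A n * wp_ratio A b c d (b * c / (a * q ^ M)) M n
        * (vw B l * wp_ratio B b' c' d' (b' * c' / (a * q ^ N)) N l)
        * (q ^ n * q ^ l * kernel_sum a A B n l)"
    if n: "n \<le> M" and l: "l \<le> N" for n l
  proof -
    have sA: "qfac (csqrt A) n \<noteq> 0" "qfac (- csqrt A) n \<noteq> 0" and AB: "qfac (A * B / a) n \<noteq> 0"
      using den_n'[OF n] by auto
    have sB: "qfac (csqrt B) l \<noteq> 0" "qfac (- csqrt B) l \<noteq> 0" and AB': "qfac (A * B / a) l \<noteq> 0"
      using den_l'[OF l] by auto
    have ge: "qfac (a * q / B) (n - l) \<noteq> 0" if "l \<le> n"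
      using den_diff[OF n l] qpoch_diff[OF that] by (simp add: mult.commute)
    have less: "qfac (A / a / q ^ (l - n)) (l - n) \<noteq> 0" if "n < l"
    proof -
      have "l - n \<le> N"
        using l by simp
      from def_neg(1)[OF this] show ?thesis
        unfolding qpoch_of_nat power_int_neg by simp
    qed
    have ks: "q ^ n * q ^ l * kernel_sum a A B n l
        = qpoch (A / a) q (int n - int l) / qpoch (a * q / B) q (int n - int l)
      * (qfac (A * B / a) (n + l) / qfac (a * q) (n + l)) * (qfac (a * q / B) n / qfac (A * B / a) n)
      * (qfac (a * q / A) l / qfac (A * B / a) l) * (q ^ n * (A * B / a\<^sup>2) ^ l / (qfac q n * qfac q l))"
      by (rule kernel_sum_qpoch[symmetric]) (fact nonzero AB AB' aq[OF n l] | erule ge | erule less)+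
    have sum_idx: "int n + int l = int (n + l)"
      by simp
    show ?thesis
      unfolding sum_idx qpoch_of_nat e_alt qpochs_vw_ratio[OF sA] qpochs_vw_ratio[OF sB] ks
        e_def[symmetric] e'_def[symmetric] comm(1)[of a] comm(2)[of a]
      by (simp only: mult_ac)
  qed
  show ?thesis
    unfolding d_def[symmetric] d'_def[symmetric] qpochs_prefactor
      vwp_series_eq_sum[OF nonzero(2-4) den_a(7,8)] atLeast0AtMost aq_d
    by (rule trans[OF _ double_sum_transform[OF nonzero(2-8) d_alt _ den_A den_B den_a(1-6)[unfolded aq_d]]])
      ((intro sum.cong[OF refl] summand; simp), rule aq)
qed

end
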